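(* Let $(p_N)_{N\ge 1}$ be a sequence in $[0,1]$ and, for each $N$, let $G_N\sim G(N,p_N)$ be an Erdős–Rényi random graph. Diagonal identifiability occurs with a sharp phase transition with threshold function $\log N/N$; that is, for any $\varepsilon>0$: \begin{itemize} \item if $p_N\geq(1+\varepsilon)\frac{\log N}{N}$ for all $N$, then the probability that $\operatorname{Supp}(G_N)$ is diagonally identifiable tends to $1$ as $N\to\infty$; \item if $p_N\leq(1-\varepsilon)\frac{\log N}{N}$ for all $N$, then the probability that $\operatorname{Supp}(G_N)$ is diagonally identifiable tends to $0$ as $N\to\infty$. \end{itemize}
   Context: $[1,N]=\{1,\dots,N\}$. $G(N,p)$ is the random simple undirected graph (no self-loops) on vertex set $[1,N]$ in which each of the $N(N-1)/2$ possible edges is present independently with probability $p$. $\operatorname{Supp}(G_N)\subseteq[1,N]^2$ is the edge set of $G_N$, seen as the symmetric set of pairs $(i,j)$ such that $\{i,j\}$ is an edge (it contains no pair $(i,i)$). For $S\subseteq[1,N]^2$, $\mathcal E(S)$ denotes the linear space of real symmetric $N\times N$ matrices $\mathsf A$ whose support $\{(i,j):\mathsf A_{ij}\neq0\}$ is included in $S$. A set $S\subseteq[1,N]^2$ with no diagonal pair $(i,i)$ is called diagonally identifiable if for almost every $\mathsf A\in\mathcal E(S)$ (with respect to Lebesgue measure on the vector space $\mathcal E(S)$), every real symmetric $N\times N$ matrix $\mathsf B$ with zero diagonal and $\mathsf A\mathsf B=\mathsf B\mathsf A$ is of the form $\mathsf B=\lambda\mathsf A$ for some $\lambda\in\mathbb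 R$. *)

theory Defs
  imports "HOL-Probability.Probability" "Jordan_Normal_Form.Matrix"
begin

text \<open>
  Matrices of type \<open>real mat\<close> have rows and columns indexed from 0, so the vertex set
  \<open>[1,N]\<close> is rendered as \<open>{..<N}\<close> throughout.
\<close>

definition sym_mats :: "nat \<Rightarrow> real mat set" where
  "sym_mats N = {A \<in> carrier_mat N N. transpose_mat A = A}"

definition mat_support :: "real mat \<Rightarrow> (nat \<times> nat) set" where
  "mat_support A = {(i, j). i < dim_row A \<and> j < dim_col A \<and> A $$ (i, j) \<noteq> 0}"

definition sym_space :: "nat \<Rightarrow> (nat \<times> nat) set \<Rightarrow> real mat set" where
  "sym_space N S = {A \<in> sym_mats N. mat_support A \<subseteq> S}"

text \<open>
  Lebesgue measure on \<open>sym_space N S\<close> is transported from the product of copies of \<open>lborel\<close>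
  along the linear isomorphism that reads off the free entries on and above the diagonal
  (see \<open>bij_betw_coords\<close> and \<open>space_sym_lebesgue\<close>). A different choice of linear coordinates
  only rescales the measure, hence gives the same null sets.
\<close>

definition free_entries :: "(nat \<times> nat) set \<Rightarrow> (nat \<times> nat) set" where
  "free_entries S = {(i, j). i \<le> j \<and> (i, j) \<in> S \<and> (j, i) \<in> S}"

definition mat_of_coords :: "nat \<Rightarrow> (nat \<times> nat) set \<Rightarrow> (nat \<times> nat \<Rightarrow> real) \<Rightarrow> real mat" where
  "mat_of_coords N S x =
     mat N N (\<lambda>(i, j). if (min i j, max i j) \<in> free_entries S then x (min i j, max i j) else 0)"

definition sym_lebesgue :: "nat \<Rightarrow> (nat \<times> nat) set \<Rightarrow> real mat measure" where
  "sym_lebesgue N S = embed_measure (\<Pi>\<^sub>M e\<in>free_entries S. lborel) (mat_of_coords N S)"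

definition diagonally_identifiable :: "nat \<Rightarrow> (nat \<times> nat) set \<Rightarrow> bool" where
  "diagonally_identifiable N S \<longleftrightarrow>
     S \<subseteq> {..<N} \<times> {..<N} \<and> (\<forall>i. (i, i) \<notin> S) \<and>
     (AE A in sym_lebesgue N S.
        \<forall>B \<in> sym_mats N. (\<forall>i<N. B $$ (i, i) = 0) \<and> A * B = B * A
           \<longrightarrow> (\<exists>c. B = c \<cdot>\<^sub>m A))"

definition all_edges :: "nat \<Rightarrow> nat set set" where
  "all_edges N = {e. e \<subseteq> {..<N} \<and> card e = 2}"

text \<open>
  The law of $G(N,p)$, a graph being given by its set of edges. \<open>bernoulli_pmf\<close> is only
  meaningful for \<open>p\<close> in \<open>{0..1}\<close>.
\<close>

definition erdos_renyi :: "nat \<Rightarrow> real \<Rightarrow> nat set set pmf" where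
  "erdos_renyi N p =
     map_pmf (\<lambda>f. {e \<in> all_edges N. f e}) (Pi_pmf (all_edges N) False (\<lambda>_. bernoulli_pmf p))"

definition Supp :: "nat set set \<Rightarrow> (nat \<times> nat) set" where
  "Supp G = {(i, j). {i, j} \<in> G}"

lemma bij_betw_coords:
  assumes "S \<subseteq> {..<N} \<times> {..<N}"
  shows "bij_betw (mat_of_coords N S) (free_entries S \<rightarrow>\<^sub>E UNIV) (sym_space N S)"
proof -
  have lt: "i < N \<and> j < N" if "(i, j) \<in> free_entries S" for i j
    using that assms by (auto simp: free_entries_def)
  have "inj_on (mat_of_coords N S) (free_entries S \<rightarrow>\<^sub>E UNIV)"
  proof (rule inj_onI)
    fix x y
    assume x: "x \<in> free_entries S \<rightarrow>\<^sub>E (UNIV :: real set)"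
      and y: "y \<in> free_entries S \<rightarrow>\<^sub>E (UNIV :: real set)"
      and eq: "mat_of_coords N S x = mat_of_coords N S y"
    show "x = y"
    proof (rule PiE_ext[OF x y])
      fix e assume e: "e \<in> free_entries S"
      obtain i j where ij: "e = (i, j)" by (cases e)
      have le: "i \<le> j" using e ij by (auto simp: free_entries_def)
      have "mat_of_coords N S x $$ (i, j) = mat_of_coords N S y $$ (i, j)"
        using eq by simp
      then show "x e = y e"
        using e ij le lt[of i j] by (simp add: mat_of_coords_def min_absorb1 max_absorb2)
    qed
  qed
  moreover have "mat_of_coords N S ` (free_entries S \<rightarrow>\<^sub>E UNIV) = sym_space N S"
  proof (intro equalityI subsetI)
    fix A assume "A \<in> mat_of_coords N S ` (free_entries S \<rightarrow>\<^sub>E UNIV)"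
    then show "A \<in> sym_space N S"
      by (auto simp: sym_space_def sym_mats_def mat_support_def mat_of_coords_def
          free_entries_def min_def max_def split: if_splits)
  next
    fix A assume A: "A \<in> sym_space N S"
    then have car: "A \<in> carrier_mat N N" and tr: "transpose_mat A = A"
      and supp: "\<And>i j. i < N \<Longrightarrow> j < N \<Longrightarrow> A $$ (i, j) \<noteq> 0 \<Longrightarrow> (i, j) \<in> S"
      by (auto simp: sym_space_def sym_mats_def mat_support_def)
    have sym: "A $$ (i, j) = A $$ (j, i)" if "i < N" "j < N" for i j
      using arg_cong[OF tr, of "\<lambda>M. M $$ (j, i)"] car that by simp
    have "A = mat_of_coords N S (restrict (\<lambda>e. A $$ e) (free_entries S))"
    proof (rule eq_matI)
      fix i j
      assume "i < dim_row (mat_of_coords N S (restrict (\<lambda>e. A $$ e) (free_entries S)))"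
        and "j < dim_col (mat_of_coords N S (restrict (\<lambda>e. A $$ e) (free_entries S)))"
      then have "i < N" "j < N" by (auto simp: mat_of_coords_def)
      then show "A $$ (i, j) =
          mat_of_coords N S (restrict (\<lambda>e. A $$ e) (free_entries S)) $$ (i, j)"
        using sym[of i j] supp[of i j] supp[of j i]
        by (auto simp: mat_of_coords_def free_entries_def min_def max_def)
    qed (use car in \<open>auto simp: mat_of_coords_def\<close>)
    then show "A \<in> mat_of_coords N S ` (free_entries S \<rightarrow>\<^sub>E UNIV)"
      by (intro image_eqI[of _ _ "restrict (\<lambda>e. A $$ e) (free_entries S)"]) auto
  qed
  ultimately show ?thesis by (simp add: bij_betw_def)
qed

lemma space_sym_lebesgue:
  assumes "S \<subseteq> {..<N} \<times> {..<N}"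
  shows "space (sym_lebesgue N S) = sym_space N S"
  using bij_betw_coords[OF assms]
  by (simp add: sym_lebesgue_def space_embed_measure space_PiM bij_betw_def)

lemma Supp_erdos_renyi:
  assumes "G \<in> set_pmf (erdos_renyi N p)"
  shows "Supp G \<subseteq> {..<N} \<times> {..<N}" and "(i, i) \<notin> Supp G"
  using assms by (auto simp: erdos_renyi_def Supp_def all_edges_def)

end

theory Submission
  imports Defs "Jordan_Normal_Form.Determinant" "HOL-Combinatorics.Cycles" "HOL-Real_Asymp.Real_Asymp"
begin

text \<open>
  Below the threshold there are two isolated vertices \<open>u\<close>, \<open>w\<close> with high probability (second
  moment method), and the matrix supported on \<open>(u, w)\<close> and \<open>(w, u)\<close> commutes with every admissible
  \<open>A\<close>.

  Above the threshold, note that identifiability at one \<open>A\<close> implies it at almost every \<open>A\<close>, since it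
  is the nonvanishing of a polynomial. A triangle is identifiable, and identifiability survives the
  addition of a vertex \<open>z\<close> to \<open>V\<close> as soon as a generic matrix on \<open>V\<close> is nonsingular: give all edges
  at \<open>z\<close> the weight 0. A generic matrix on \<open>V\<close> is nonsingular if some permutation of \<open>V\<close> moves every
  vertex to a neighbour, and by Hall's theorem this holds if every \<open>S\<close> contained in \<open>V\<close> has at least
  \<open>card S\<close> neighbours in \<open>V\<close>. Expose the graph in two independent layers. Depth-first search in the
  first layer, which is sparse but joins any two large sets, yields a path through almost all
  vertices. In the second layer a chord closes a triangle at an early position of the path, every
  vertex has many neighbours on the path, and small sets span few edges; hence every vertex set
  containing the path from the triangle on satisfies Hall's condition. So one starts at the
  triangle, follows the path, and adds the remaining vertices in any order.
\<close>

section \<open>Generic points of polynomial families\<close>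

text \<open>The extension step asks for no edge at the new vertex; the whole effort goes into
  keeping the current vertex set nonsingular. With zero diagonal, a path on an odd number of
  vertices is singular for all weights, so a bare path cannot be followed vertex by vertex. The
  triangle removes this parity obstacle.

  Two layers are used because the path must be known before chord, degrees and sparsity are
  estimated: it is a function of the first layer alone, so for the second it may be treated as
  deterministic. Joining any two sets of linear size takes only a small multiple of log N / N, so
  the first layer can be given just e/4 of the surplus. The second keeps the factor 1 + e/2, which
  gives every vertex at least c log N neighbours on the path.

  Hall's condition is split by size. Small sets expand because of degrees and sparsity. For a large
  set the condition is turned, by passing to the vertices without neighbours in it, into a statement
  about small sets or about edges between two large sets.\<close>

definition coordinatewise_poly :: "'e set \<Rightarrow> (('e \<Rightarrow> real) \<Rightarrow> real) \<Rightarrow> bool" where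
  "coordinatewise_poly E f \<longleftrightarrow> (\<forall>x. \<forall>e\<in>E. \<exists>q. \<forall>t. f (x(e := t)) = poly q t)"

lemma coordinatewise_poly_const: "coordinatewise_poly E (\<lambda>x. c)"
  unfolding coordinatewise_poly_def by (auto intro: exI[of _ "[:c:]"])

lemma coordinatewise_poly_coord: "coordinatewise_poly E (\<lambda>x. x i)"
  unfolding coordinatewise_poly_def
proof (intro allI ballI)
  fix x :: "'a \<Rightarrow> real" and e
  show "\<exists>q. \<forall>t. (x(e := t)) i = poly q t"
    by (cases "i = e") (auto intro: exI[of _ "[:x i:]"] exI[of _ "[:0, 1:]"])
qed

lemma coordinatewise_poly_add:
  assumes "coordinatewise_poly E f" "coordinatewise_poly E g"
  shows "coordinatewise_poly E (\<lambda>x. f x + g x)"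
  unfolding coordinatewise_poly_def
proof (intro allI ballI)
  fix x e assume "e \<in> E"
  then obtain q r where "\<forall>t. f (x(e := t)) = poly q t" "\<forall>t. g (x(e := t)) = poly r t"
    using assms unfolding coordinatewise_poly_def by meson
  then show "\<exists>q. \<forall>t. f (x(e := t)) + g (x(e := t)) = poly q t"
    by (auto intro: exI[of _ "q + r"])
qed

lemma coordinatewise_poly_mult:
  assumes "coordinatewise_poly E f" "coordinatewise_poly E g"
  shows "coordinatewise_poly E (\<lambda>x. f x * g x)"
  unfolding coordinatewise_poly_def
proof (intro allI ballI)
  fix x e assume "e \<in> E"
  then obtain q r where "\<forall>t. f (x(e := t)) = poly q t" "\<forall>t. g (x(e := t)) = poly r t"
    using assms unfolding coordinatewise_poly_def by meson
  then show "\<exists>q. \<forall>t. f (x(e := t)) * g (x(e := t)) = poly q t"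
    by (auto intro: exI[of _ "q * r"])
qed

lemma coordinatewise_poly_diff:
  assumes "coordinatewise_poly E f" "coordinatewise_poly E g"
  shows "coordinatewise_poly E (\<lambda>x. f x - g x)"
proof -
  have "coordinatewise_poly E (\<lambda>x. f x + (-1) * g x)"
    by (intro coordinatewise_poly_add coordinatewise_poly_mult coordinatewise_poly_const assms)
  then show ?thesis by simp
qed

lemma coordinatewise_poly_sum:
  assumes "\<And>i. i \<in> I \<Longrightarrow> coordinatewise_poly E (f i)"
  shows "coordinatewise_poly E (\<lambda>x. \<Sum>i\<in>I. f i x)"
  using assms
  by (induction I rule: infinite_finite_induct)
     (auto intro: coordinatewise_poly_add coordinatewise_poly_const)

lemma coordinatewise_poly_prod:
  assumes "\<And>i. i \<in> I \<Longrightarrow> coordinatewise_poly E (f i)"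
  shows "coordinatewise_poly E (\<lambda>x. \<Prod>i\<in>I. f i x)"
  using assms
  by (induction I rule: infinite_finite_induct)
     (auto intro: coordinatewise_poly_mult coordinatewise_poly_const)

lemmas coordinatewise_poly_intros =
  coordinatewise_poly_const coordinatewise_poly_coord coordinatewise_poly_add
  coordinatewise_poly_mult coordinatewise_poly_diff coordinatewise_poly_sum
  coordinatewise_poly_prod

text \<open>Fubini, peeling off one coordinate. With \<open>e\<close> frozen at its value in
  \<open>a\<close>, the induction hypothesis makes \<open>f\<close> nonzero for almost every choice
  of the other coordinates; then \<open>f\<close> is a nonzero polynomial in \<open>e\<close> and
  has finitely many roots. Of polynomiality, only the dependence on one coordinate at a time is
  used.\<close>

lemma AE_coordinatewise_poly_nonzero:
  fixes f :: "('e \<Rightarrow> real) \<Rightarrow> real"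
  assumes "finite E" "coordinatewise_poly E f" "f \<in> borel_measurable (\<Pi>\<^sub>M e\<in>E. lborel)"
    and "a \<in> space (\<Pi>\<^sub>M e\<in>E. (lborel :: real measure))" "f a \<noteq> 0"
  shows "AE x in (\<Pi>\<^sub>M e\<in>E. lborel). f x \<noteq> 0"
  using assms
proof (induction E arbitrary: f a rule: finite_induct)
  case empty
  then show ?case by (intro AE_I2) (auto simp: space_PiM)
next
  case (insert e E)
  interpret product_sigma_finite "\<lambda>_::'e. lborel :: real measure"
    by standard
  let ?M = "\<Pi>\<^sub>M e\<in>E. (lborel :: real measure)" and ?M' = "\<Pi>\<^sub>M e\<in>insert e E. (lborel :: real measure)"
  define t0 where "t0 = a e"
  \<comment> \<open>Points of the product over \<open>E\<close> are extensional, so the value at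
    \<open>e\<close> is reset to \<open>undefined\<close>.\<close>
  define x1 where "x1 = a(e := undefined)"
  note meas = insert.prems(2)
  have meas_upd: "(\<lambda>x. f (x(e := t))) \<in> borel_measurable ?M" for t
  proof -
    have "(\<lambda>x. x(e := t)) \<in> measurable ?M ?M'"
      by (rule measurable_fun_upd[where J = E]) auto
    from measurable_compose[OF this meas] show ?thesis .
  qed
  have "AE x in ?M. f (x(e := t0)) \<noteq> 0"
  proof (rule insert.IH[where a = x1])
    show "coordinatewise_poly E (\<lambda>x. f (x(e := t0)))"
      unfolding coordinatewise_poly_def
    proof (intro allI ballI)
      fix x e' assume e': "e' \<in> E"
      then have "e' \<noteq> e" using insert.hyps by auto
      then have "x(e' := t, e := t0) = (x(e := t0))(e' := t)" for t by (rule fun_upd_twist)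
      then show "\<exists>q. \<forall>t. f (x(e' := t, e := t0)) = poly q t"
        using insert.prems(1) e' by (auto simp: coordinatewise_poly_def)
    qed
    show "x1 \<in> space ?M"
      using insert.prems(3) insert.hyps
      by (auto simp: space_PiM x1_def PiE_def extensional_def)
    show "f (x1(e := t0)) \<noteq> 0" using insert.prems(4) by (simp add: x1_def t0_def)
  qed (rule meas_upd)
  then have AE_inner: "AE x in ?M. (\<integral>\<^sup>+t. indicator {x \<in> space ?M'. f x = 0} (x(e := t)) \<partial>lborel) = 0"
  proof eventually_elim
    case (elim x)
    obtain q where q: "\<And>t. f (x(e := t)) = poly q t"
      using insert.prems(1) unfolding coordinatewise_poly_def by blast
    have "q \<noteq> 0" using elim q by auto
    then have "finite {t. poly q t = 0}" by (rule poly_roots_finite)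
    then have null: "{t. poly q t = 0} \<in> null_sets lborel"
      by (intro countable_imp_null_set_lborel countable_finite)
    have "(\<integral>\<^sup>+t. indicator {x \<in> space ?M'. f x = 0} (x(e := t)) \<partial>lborel)
        \<le> (\<integral>\<^sup>+t. indicator {t. poly q t = 0} t \<partial>lborel)"
      by (intro nn_integral_mono) (auto simp: indicator_def q)
    also have "\<dots> = emeasure lborel {t. poly q t = 0}"
      using null by (intro nn_integral_indicator) auto
    also have "\<dots> = 0" using null by auto
    finally show ?case by simp
  qed
  have Z: "{x \<in> space ?M'. f x = 0} \<in> sets ?M'"
    using measurable_sets[OF meas, of "{0}"] by (simp add: vimage_def Int_def conj_commute)
  have "emeasure ?M' {x \<in> space ?M'. f x = 0}
      = (\<integral>\<^sup>+x. indicator {x \<in> space ?M'. f x = 0} x \<partial>?M')"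
    using Z by simp
  also have "\<dots> = (\<integral>\<^sup>+x. (\<integral>\<^sup>+t. indicator {x \<in> space ?M'. f x = 0} (x(e := t)) \<partial>lborel) \<partial>?M)"
    using insert.hyps Z by (intro product_nn_integral_insert) auto
  also have "\<dots> = (\<integral>\<^sup>+x. 0 \<partial>?M)" by (rule nn_integral_cong_AE[OF AE_inner])
  also have "\<dots> = 0" by simp
  finally show ?case
    using Z by (subst AE_iff_measurable[OF _ refl]) auto
qed

text \<open>The total mass is positive (infinite unless \<open>E\<close> is empty). This turns an
  almost-everywhere statement back into a witness.\<close>

lemma not_AE_False_PiM_lborel:
  assumes "finite E"
  shows "\<not> (AE x in (\<Pi>\<^sub>M e\<in>E. (lborel :: real measure)). False)"
proof
  interpret product_sigma_finite "\<lambda>_::'a. lborel :: real measure"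
    by standard
  let ?M = "\<Pi>\<^sub>M e\<in>E. (lborel :: real measure)"
  assume "AE x in ?M. False"
  then have "emeasure ?M (space ?M) = 0"
    by (subst (asm) AE_iff_measurable[OF _ refl]) auto
  moreover have "emeasure ?M (space ?M) = (\<Prod>e\<in>E. emeasure lborel (UNIV :: real set))"
    using emeasure_PiM[of E "\<lambda>_. UNIV"] assms by (simp add: space_PiM)
  ultimately show False using assms by simp
qed

lemma coordinatewise_poly_det:
  assumes "\<And>k l. coordinatewise_poly E (\<lambda>x. g x k l)"
  shows "coordinatewise_poly E (\<lambda>x. det (mat n n (\<lambda>(k, l). g x k l)))"
proof -
  have "det (mat n n (\<lambda>(k, l). g x k l)) =
      (\<Sum>p | p permutes {0..<n}. signof p * (\<Prod>i = 0..<n. g x i (p i)))" for x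
    unfolding det_def
    by (auto intro!: sum.cong prod.cong simp: permutes_in_image)
  then show ?thesis
    by (auto intro!: coordinatewise_poly_intros assms)
qed

lemma measurable_det:
  assumes "\<And>k l. (\<lambda>x. g x k l) \<in> borel_measurable M"
  shows "(\<lambda>x. det (mat n n (\<lambda>(k, l). g x k l)) :: real) \<in> borel_measurable M"
proof -
  have "det (mat n n (\<lambda>(k, l). g x k l)) =
      (\<Sum>p | p permutes {0..<n}. signof p * (\<Prod>i = 0..<n. g x i (p i)))" for x
    unfolding det_def
    by (auto intro!: sum.cong prod.cong simp: permutes_in_image)
  then show ?thesis
    using assms by simp
qed

section \<open>Generic injectivity of linear maps with polynomial coefficients\<close>

definition trivial_kernel :: "'j set \<Rightarrow> 'i set \<Rightarrow> ('j \<Rightarrow> 'i \<Rightarrow> real) \<Rightarrow> bool" where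
  "trivial_kernel J I L \<longleftrightarrow> (\<forall>c. (\<forall>j\<in>J. (\<Sum>i\<in>I. L j i * c i) = 0) \<longrightarrow> (\<forall>i\<in>I. c i = 0))"

text \<open>The matrix is the Gram matrix of the columns of \<open>L\<close>. If it kills
  \<open>v\<close>, then \<open>v\<close> paired with its image is the sum of the squares of the
  entries of \<open>L\<close> applied to \<open>v\<close>, so \<open>L\<close> kills
  \<open>v\<close>. Injectivity of a map between spaces of different dimensions thus becomes the
  nonvanishing of one polynomial.\<close>

lemma trivial_kernel_iff_det_Gram:
  assumes h: "bij_betw h {..<m} I" and J: "finite J"
  shows "trivial_kernel J I L \<longleftrightarrow>
    det (mat m m (\<lambda>(k, l). \<Sum>j\<in>J. L j (h k) * L j (h l))) \<noteq> 0" (is "_ \<longleftrightarrow> det ?G \<noteq> 0")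
proof -
  have G: "?G \<in> carrier_mat m m" by simp
  have Gv: "(?G *\<^sub>v v) $ k = (\<Sum>j\<in>J. L j (h k) * (\<Sum>l<m. L j (h l) * v $ l))"
    if "v \<in> carrier_vec m" "k < m" for v k
  proof -
    have "(?G *\<^sub>v v) $ k = (\<Sum>l<m. (\<Sum>j\<in>J. L j (h k) * L j (h l)) * v $ l)"
      using that by (simp add: scalar_prod_def lessThan_atLeast0)
    also have "\<dots> = (\<Sum>l<m. \<Sum>j\<in>J. L j (h k) * (L j (h l) * v $ l))"
      by (simp add: sum_distrib_right mult.assoc)
    also have "\<dots> = (\<Sum>j\<in>J. \<Sum>l<m. L j (h k) * (L j (h l) * v $ l))"
      by (rule sum.swap)
    finally show ?thesis by (simp add: sum_distrib_left)
  qed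
  have reidx: "(\<Sum>i\<in>I. L j i * c i) = (\<Sum>l<m. L j (h l) * c (h l))" for j c
    by (rule sum.reindex_bij_betw[OF h, symmetric])
  show ?thesis
  proof
    assume triv: "trivial_kernel J I L"
    show "det ?G \<noteq> 0"
    proof
      assume "det ?G = 0"
      then obtain v where v: "v \<in> carrier_vec m" "v \<noteq> 0\<^sub>v m" "?G *\<^sub>v v = 0\<^sub>v m"
        using det_0_iff_vec_prod_zero[OF G] by auto
      define s where "s j = (\<Sum>l<m. L j (h l) * v $ l)" for j
      have "(\<Sum>j\<in>J. s j * s j) = (\<Sum>j\<in>J. \<Sum>k<m. v $ k * (L j (h k) * s j))"
        unfolding sum_distrib_right[symmetric] s_def
        by (intro sum.cong refl) (simp add: sum_distrib_right sum_distrib_left mult_ac)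
      also have "\<dots> = (\<Sum>k<m. v $ k * (\<Sum>j\<in>J. L j (h k) * s j))"
        by (subst sum.swap) (simp add: sum_distrib_left)
      also have "\<dots> = (\<Sum>k<m. v $ k * (?G *\<^sub>v v) $ k)"
        using v(1) by (intro sum.cong refl) (simp only: Gv s_def lessThan_iff)
      also have "\<dots> = 0" using v(3) by simp
      finally have s0: "\<forall>j\<in>J. s j = 0"
        using J by (subst (asm) sum_nonneg_eq_0_iff) auto
      define c where "c i = v $ (the_inv_into {..<m} h i)" for i
      have ch: "c (h l) = v $ l" if "l < m" for l
        using that h by (auto simp: c_def bij_betw_def the_inv_into_f_f)
      have "(\<Sum>i\<in>I. L j i * c i) = 0" if "j \<in> J" for j
        using s0 that by (simp add: reidx ch s_def)
      then have "\<forall>i\<in>I. c i = 0"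
        using triv unfolding trivial_kernel_def by blast
      then have "v $ l = 0" if "l < m" for l
        using ch[OF that] h that by (auto simp: bij_betw_def)
      then show False using v by (auto intro: eq_vecI)
    qed
  next
    assume det: "det ?G \<noteq> 0"
    show "trivial_kernel J I L"
      unfolding trivial_kernel_def
    proof (intro allI impI)
      fix c assume c: "\<forall>j\<in>J. (\<Sum>i\<in>I. L j i * c i) = 0"
      define v where "v = vec m (\<lambda>k. c (h k))"
      have v: "v \<in> carrier_vec m" by (simp add: v_def)
      have "(\<Sum>l<m. L j (h l) * v $ l) = 0" if "j \<in> J" for j
        using c that reidx[of j c] by (simp add: v_def)
      then have "?G *\<^sub>v v = 0\<^sub>v m"
        using v by (intro eq_vecI) (auto simp add: Gv simp del: index_mult_mat_vec)
      then have "v = 0\<^sub>v m" using det det_0_iff_vec_prod_zero[OF G] v by auto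
      then have "c (h k) = 0" if "k < m" for k
        using that by (metis index_vec index_zero_vec(1) v_def)
      then show "\<forall>i\<in>I. c i = 0" using h by (auto simp: bij_betw_def)
    qed
  qed
qed

text \<open>The Gram determinant is polynomial in the parameters, and \<open>a\<close> is a point
  where it does not vanish.\<close>

lemma AE_trivial_kernel:
  assumes E: "finite E" and I: "finite I" and J: "finite J"
    and poly: "\<And>j i. coordinatewise_poly E (\<lambda>x. L x j i)"
    and meas: "\<And>j i. (\<lambda>x. L x j i) \<in> borel_measurable (\<Pi>\<^sub>M e\<in>E. (lborel :: real measure))"
    and a: "a \<in> space (\<Pi>\<^sub>M e\<in>E. (lborel :: real measure))" "trivial_kernel J I (L a)"
  shows "AE x in (\<Pi>\<^sub>M e\<in>E. lborel). trivial_kernel J I (L x)"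
proof -
  obtain h where h: "bij_betw h {..<card I} I"
    using ex_bij_betw_nat_finite[OF I] by (auto simp: lessThan_atLeast0)
  show ?thesis
    unfolding trivial_kernel_iff_det_Gram[OF h J]
  proof (rule AE_coordinatewise_poly_nonzero[OF E])
    show "det (mat (card I) (card I) (\<lambda>(k, l). \<Sum>j\<in>J. L a j (h k) * L a j (h l))) \<noteq> 0"
      using a(2) by (simp add: trivial_kernel_iff_det_Gram[OF h J])
    show "coordinatewise_poly E
        (\<lambda>x. det (mat (card I) (card I) (\<lambda>(k, l). \<Sum>j\<in>J. L x j (h k) * L x j (h l))))"
      by (intro coordinatewise_poly_det coordinatewise_poly_intros poly)
    show "(\<lambda>x. det (mat (card I) (card I) (\<lambda>(k, l). \<Sum>j\<in>J. L x j (h k) * L x j (h l))))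
        \<in> borel_measurable (\<Pi>\<^sub>M e\<in>E. (lborel :: real measure))"
      by (intro measurable_det borel_measurable_sum borel_measurable_times meas)
  qed (rule a(1))
qed

text \<open>Matrices are functions on all vertices, cut down to \<open>V\<close> by the range of the
  sums, so that enlarging the vertex set involves no renumbering.\<close>

definition nonsingular_on :: "'v set \<Rightarrow> ('v \<Rightarrow> 'v \<Rightarrow> real) \<Rightarrow> bool" where
  "nonsingular_on V A \<longleftrightarrow> (\<forall>v. (\<forall>i\<in>V. (\<Sum>j\<in>V. A i j * v j) = 0) \<longrightarrow> (\<forall>i\<in>V. v i = 0))"

text \<open>
  Fixing the value of \<open>B\<close> at one edge \<open>e\<close> removes the line spanned by \<open>A\<close> itself, so that
  identifiability becomes the injectivity of a linear map.
\<close>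

definition rigid_on :: "'v set \<Rightarrow> 'v set \<Rightarrow> ('v \<Rightarrow> 'v \<Rightarrow> real) \<Rightarrow> bool" where
  "rigid_on V e A \<longleftrightarrow> (\<forall>B.
     (\<forall>i\<in>V. \<forall>j\<in>V. B i j = B j i) \<and> (\<forall>i\<in>V. B i i = 0) \<and>
     (\<forall>i\<in>V. \<forall>j\<in>V. {i, j} = e \<longrightarrow> B i j = 0) \<and>
     (\<forall>i\<in>V. \<forall>j\<in>V. (\<Sum>k\<in>V. A i k * B k j) = (\<Sum>k\<in>V. B i k * A k j))
     \<longrightarrow> (\<forall>i\<in>V. \<forall>j\<in>V. B i j = 0))"

lemma nonsingular_on_iff_trivial_kernel: "nonsingular_on V A \<longleftrightarrow> trivial_kernel V V A"
  by (simp add: nonsingular_on_def trivial_kernel_def)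

text \<open>The unknowns are the values of \<open>B\<close> on unordered pairs other than
  \<open>e\<close>, which encodes symmetry, the zero diagonal and the normalisation at once; the
  equations are the entries of the commutator. The column of \<open>f\<close> is the commutator of
  \<open>A\<close> with the symmetric matrix that has ones at the two positions of
  \<open>f\<close>.\<close>

lemma rigid_on_iff_trivial_kernel:
  assumes V: "finite V"
  shows "rigid_on V e A \<longleftrightarrow>
    trivial_kernel (V \<times> V) {f. f \<subseteq> V \<and> card f = 2 \<and> f \<noteq> e}
      (\<lambda>(i, j) f. \<Sum>k\<in>V. A i k * of_bool ({k, j} = f) - of_bool ({i, k} = f) * A k j)"
    (is "_ \<longleftrightarrow> trivial_kernel _ ?I ?L")
proof -
  have I: "finite ?I" using V by (auto intro: finite_subset[of _ "Pow V"])
  have card2: "{i, j} \<in> ?I \<longleftrightarrow> i \<noteq> j \<and> {i, j} \<noteq> e" if "i \<in> V" "j \<in> V" for i j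
    using that by (auto simp: card_insert_if)
  have expand: "(\<Sum>f\<in>?I. ?L (i, j) f * c f) = (\<Sum>k\<in>V. A i k * (if {k, j} \<in> ?I then c {k, j} else 0))
      - (\<Sum>k\<in>V. (if {i, k} \<in> ?I then c {i, k} else 0) * A k j)" for i j c
  proof -
    have "(\<Sum>f\<in>?I. ?L (i, j) f * c f) =
        (\<Sum>f\<in>?I. \<Sum>k\<in>V. A i k * (of_bool ({k, j} = f) * c f) - (of_bool ({i, k} = f) * c f) * A k j)"
      by (intro sum.cong refl) (simp add: sum_distrib_left algebra_simps)
    also have "\<dots> = (\<Sum>k\<in>V. A i k * (\<Sum>f\<in>?I. of_bool ({k, j} = f) * c f)
        - (\<Sum>f\<in>?I. of_bool ({i, k} = f) * c f) * A k j)"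
      by (subst sum.swap) (simp add: sum_subtractf sum_distrib_left sum_distrib_right)
    also have "\<dots> = (\<Sum>k\<in>V. A i k * (if {k, j} \<in> ?I then c {k, j} else 0)
        - (if {i, k} \<in> ?I then c {i, k} else 0) * A k j)"
    proof -
      have "(\<Sum>f\<in>?I. of_bool (g = f) * c f) = (if g \<in> ?I then c g else 0)" for g
      proof -
        have "(\<Sum>f\<in>?I. of_bool (g = f) * c f) = (\<Sum>f\<in>?I. if g = f then c f else 0)"
          by (intro sum.cong) auto
        then show ?thesis using sum.delta'[OF I, of g c] by simp
      qed
      then show ?thesis by (intro sum.cong refl) simp
    qed
    finally show ?thesis by (simp add: sum_subtractf)
  qed
  show ?thesis
  proof
    assume rigid: "rigid_on V e A"
    show "trivial_kernel (V \<times> V) ?I ?L"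
      unfolding trivial_kernel_def
    proof (intro allI impI ballI)
      fix c f assume c: "\<forall>ij\<in>V \<times> V. (\<Sum>f\<in>?I. ?L ij f * c f) = 0" and f: "f \<in> ?I"
      define B where "B i j = (if {i, j} \<in> ?I then c {i, j} else 0)" for i j
      have "\<forall>i\<in>V. \<forall>j\<in>V. B i j = 0"
      proof (rule rigid[unfolded rigid_on_def, THEN spec, THEN mp], intro conjI ballI impI)
        fix i j assume ij: "i \<in> V" "j \<in> V"
        show "B i j = B j i" by (simp add: B_def insert_commute)
        show "B i i = 0" by (simp add: B_def)
        show "B i j = 0" if "{i, j} = e" using that by (simp add: B_def)
        have "(\<Sum>f\<in>?I. ?L (i, j) f * c f) = 0" using c ij by blast
        then show "(\<Sum>k\<in>V. A i k * B k j) = (\<Sum>k\<in>V. B i k * A k j)"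
          unfolding expand B_def by simp
      qed
      moreover obtain i j where ij: "f = {i, j}" using f by (auto simp: card_2_iff)
      ultimately have "B i j = 0" using f by simp
      then show "c f = 0" using f unfolding B_def ij by (simp only: if_True)
    qed
  next
    assume triv: "trivial_kernel (V \<times> V) ?I ?L"
    show "rigid_on V e A"
      unfolding rigid_on_def
    proof (intro allI impI, elim conjE)
      fix B
      assume sym: "\<forall>i\<in>V. \<forall>j\<in>V. B i j = B j i" and diag: "\<forall>i\<in>V. B i i = 0"
        and edge: "\<forall>i\<in>V. \<forall>j\<in>V. {i, j} = e \<longrightarrow> B i j = 0"
        and comm: "\<forall>i\<in>V. \<forall>j\<in>V. (\<Sum>k\<in>V. A i k * B k j) = (\<Sum>k\<in>V. B i k * A k j)"
      \<comment> \<open>By symmetry of \<open>B\<close>, either ordering of the pair picked by the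
        choice operator gives the same value.\<close>
      define c where "c f = (let p = SOME p. f = {fst p, snd p} in B (fst p) (snd p))" for f
      have c: "c {i, j} = B i j" if "i \<in> V" "j \<in> V" for i j
      proof -
        define p where "p = (SOME p. {i, j} = {fst p, snd p})"
        have "{i, j} = {fst p, snd p}" unfolding p_def by (rule someI[of _ "(i, j)"]) simp
        then have "(fst p = i \<and> snd p = j) \<or> (fst p = j \<and> snd p = i)"
          by (auto simp: doubleton_eq_iff)
        then show ?thesis using sym that unfolding c_def Let_def p_def[symmetric] by auto
      qed
      have B: "(if {i, j} \<in> ?I then c {i, j} else 0) = B i j" if "i \<in> V" "j \<in> V" for i j
        using that c diag edge card2[OF that] by auto
      have "\<forall>ij\<in>V \<times> V. (\<Sum>f\<in>?I. ?L ij f * c f) = 0"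
      proof
        fix ij assume "ij \<in> V \<times> V"
        then obtain i j where ij: "ij = (i, j)" "i \<in> V" "j \<in> V" by auto
        then show "(\<Sum>f\<in>?I. ?L ij f * c f) = 0"
          unfolding ij(1) expand using comm by (simp only: B cong: sum.cong)
      qed
      then have c0: "\<forall>f\<in>?I. c f = 0" using triv unfolding trivial_kernel_def by blast
      show "\<forall>i\<in>V. \<forall>j\<in>V. B i j = 0"
      proof (intro ballI)
        fix i j assume ij: "i \<in> V" "j \<in> V"
        have "(if {i, j} \<in> ?I then c {i, j} else 0) = 0"
          using c0[rule_format, of "{i, j}"] by (simp only: split: if_split) blast
        then show "B i j = 0" using B[OF ij] by (simp only:)
      qed
    qed
  qed
qed

section \<open>Hall's marriage theorem\<close>

text \<open>Induction in the style of Halmos and Vaughan. If every nonempty proper subset has a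
  strict surplus of neighbours, match any \<open>i\<close> with any \<open>y\<close> and delete
  both: Hall's condition survives the loss of \<open>y\<close>. Otherwise some proper subset
  \<open>S\<close> is tight; match \<open>S\<close> inside its neighbourhood \<open>U\<close> and
  the rest outside \<open>U\<close>, where the condition for \<open>T\<close> follows from the one
  for the union of \<open>S\<close> and \<open>T\<close>.\<close>

theorem Hall_marriage:
  assumes "finite I" "\<And>i. i \<in> I \<Longrightarrow> finite (A i)"
    and "\<And>S. S \<subseteq> I \<Longrightarrow> card S \<le> card (\<Union>i\<in>S. A i)"
  shows "\<exists>f. inj_on f I \<and> (\<forall>i\<in>I. f i \<in> A i)"
  using assms
proof (induction "card I" arbitrary: I A rule: less_induct)
  case less
  note finI = less.prems(1) and finA = less.prems(2) and hall = less.prems(3)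
  consider "I = {}" | i where "i \<in> I" "\<And>S. S \<subset> I \<Longrightarrow> S \<noteq> {} \<Longrightarrow> card S < card (\<Union>i\<in>S. A i)"
    | S where "S \<subset> I" "S \<noteq> {}" "card (\<Union>i\<in>S. A i) \<le> card S"
    by (metis ex_in_conv not_less)
  then show ?case
  proof cases
    case 1
    then show ?thesis by simp
  next
    case (2 i)
    have "card {i} \<le> card (\<Union>i\<in>{i}. A i)" using 2(1) by (intro hall) auto
    then obtain y where y: "y \<in> A i" by fastforce
    have "\<exists>f. inj_on f (I - {i}) \<and> (\<forall>j\<in>I - {i}. f j \<in> A j - {y})"
    proof (rule less.hyps)
      show "card (I - {i}) < card I" using finI 2(1) by (meson card_Diff1_less)
    next
      fix S assume S: "S \<subseteq> I - {i}"
      show "card S \<le> card (\<Union>j\<in>S. A j - {y})"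
      proof (cases "S = {}")
        case False
        then have "card S < card (\<Union>i\<in>S. A i)" using 2 S by blast
        moreover have "(\<Union>j\<in>S. A j - {y}) = (\<Union>i\<in>S. A i) - {y}" by auto
        moreover have "finite (\<Union>i\<in>S. A i)" using S finI finA by (auto intro: finite_subset)
        ultimately show ?thesis by (auto simp: card_Diff_singleton_if)
      qed simp
    qed (use finI finA in auto)
    then obtain f where "inj_on f (I - {i})" "\<forall>j\<in>I - {i}. f j \<in> A j - {y}" by blast
    then show ?thesis
      using y by (intro exI[of _ "f(i := y)"]) (auto simp: inj_on_def)
  next
    case (3 S)
    have finS: "finite S" using 3 finI by (auto intro: finite_subset)
    define U where "U = (\<Union>i\<in>S. A i)"
    have finU: "finite U" using 3(1) finA finS by (auto simp: U_def)
    have "\<exists>f. inj_on f S \<and> (\<forall>j\<in>S. f j \<in> A j)"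
    proof (rule less.hyps)
      show "card S < card I" using 3 finI by (simp add: psubset_card_mono)
    qed (use 3(1) finA hall finS in auto)
    then obtain f where f: "inj_on f S" "\<forall>j\<in>S. f j \<in> A j" by blast
    have "\<exists>g. inj_on g (I - S) \<and> (\<forall>j\<in>I - S. g j \<in> A j - U)"
    proof (rule less.hyps)
      show "card (I - S) < card I"
        using 3 finI by (intro psubset_card_mono) auto
    next
      fix T assume T: "T \<subseteq> I - S"
      have finT: "finite T" using T finI by (auto intro: finite_subset)
      have "card S + card T = card (S \<union> T)"
        using T finS finT by (subst card_Un_disjoint) auto
      also have "\<dots> \<le> card (\<Union>i\<in>S \<union> T. A i)" using T 3(1) by (intro hall) auto
      also have "(\<Union>i\<in>S \<union> T. A i) = U \<union> (\<Union>j\<in>T. A j - U)" by (auto simp: U_def)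
      also have "card \<dots> \<le> card U + card (\<Union>j\<in>T. A j - U)" by (rule card_Un_le)
      also have "card U \<le> card S" using 3(3) by (simp add: U_def)
      finally show "card T \<le> card (\<Union>j\<in>T. A j - U)" by simp
    qed (use finI finA in auto)
    then obtain g where g: "inj_on g (I - S)" "\<forall>j\<in>I - S. g j \<in> A j - U" by blast
    have "f ` S \<inter> g ` (I - S) = {}" using f g by (auto simp: U_def)
    then have "inj_on (\<lambda>j. if j \<in> S then f j else g j) (S \<union> (I - S))"
      using f(1) g(1) by (intro inj_on_disjoint_Un)
    then have "inj_on (\<lambda>j. if j \<in> S then f j else g j) I"
      using 3(1) by (simp add: Un_absorb1 psubset_imp_subset)
    moreover have "\<forall>j\<in>I. (if j \<in> S then f j else g j) \<in> A j" using f g by auto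
    ultimately show ?thesis by blast
  qed
qed

lemma Hall_permutation:
  assumes V: "finite V" and A: "\<And>i. i \<in> V \<Longrightarrow> A i \<subseteq> V"
    and hall: "\<And>S. S \<subseteq> V \<Longrightarrow> card S \<le> card (\<Union>i\<in>S. A i)"
  obtains \<sigma> where "\<sigma> permutes V" "\<And>i. i \<in> V \<Longrightarrow> \<sigma> i \<in> A i"
proof -
  have "\<exists>f. inj_on f V \<and> (\<forall>i\<in>V. f i \<in> A i)"
    using V A hall by (intro Hall_marriage) (auto intro: finite_subset)
  then obtain f where f: "inj_on f V" "\<And>i. i \<in> V \<Longrightarrow> f i \<in> A i" by blast
  define \<sigma> where "\<sigma> i = (if i \<in> V then f i else i)" for i
  have "inj_on \<sigma> V" using f(1) by (simp add: \<sigma>_def inj_on_def)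
  moreover have "\<sigma> ` V \<subseteq> V" using f(2) A by (force simp: \<sigma>_def)
  ultimately have "bij_betw \<sigma> V V" using V by (simp add: bij_betw_def endo_inj_surj)
  then have "\<sigma> permutes V" by (rule bij_imp_permutes) (simp add: \<sigma>_def)
  then show ?thesis using f(2) that[of \<sigma>] by (simp add: \<sigma>_def)
qed

section \<open>Generic nonsingularity and rigidity on a graph\<close>

text \<open>The coordinates of the Lebesgue measure are the entries on and above the diagonal, hence
  the pair \<open>(min i j, max i j)\<close>: for the free entries of a graph, edges and coordinates
  coincide.\<close>

definition adj :: "(nat \<times> nat) set \<Rightarrow> nat \<Rightarrow> nat \<Rightarrow> bool" where
  "adj E i j \<longleftrightarrow> i \<noteq> j \<and> (min i j, max i j) \<in> E"

lemma adj_commute: "adj E i j \<longleftrightarrow> adj E j i"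
  by (auto simp: adj_def min.commute max.commute)

definition weighting :: "(nat \<times> nat) set \<Rightarrow> (nat \<Rightarrow> nat \<Rightarrow> real) \<Rightarrow> bool" where
  "weighting E A \<longleftrightarrow> (\<forall>i j. A i j = A j i \<and> (A i j \<noteq> 0 \<longrightarrow> adj E i j))"

definition weights :: "(nat \<times> nat) set \<Rightarrow> (nat \<times> nat \<Rightarrow> real) \<Rightarrow> nat \<Rightarrow> nat \<Rightarrow> real" where
  "weights E x i j = (if adj E i j then x (min i j, max i j) else 0)"

lemma weighting_weights: "weighting E (weights E x)"
  by (auto simp: weighting_def weights_def adj_commute min.commute max.commute)

text \<open>Every weighting is a point of the parameter space, so an explicit one can serve as the
  single good point from which genericity starts.\<close>

lemma weights_of_weighting:
  assumes "weighting E A"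
  shows "weights E (restrict (\<lambda>(i, j). A i j) E) = A"
proof (intro ext)
  fix i j
  show "weights E (restrict (\<lambda>(i, j). A i j) E) i j = A i j"
  proof (cases "adj E i j")
    case True
    moreover have "A (min i j) (max i j) = A i j"
      using assms by (auto simp: weighting_def min_def max_def)
    ultimately show ?thesis by (simp add: weights_def adj_def)
  next
    case False
    then show ?thesis using assms by (auto simp: weights_def weighting_def)
  qed
qed

lemma coordinatewise_poly_weights: "coordinatewise_poly E (\<lambda>x. weights F x i j)"
  unfolding weights_def by (cases "adj F i j") (auto intro: coordinatewise_poly_intros)

lemma measurable_weights:
  "(\<lambda>x. weights E x i j) \<in> borel_measurable (\<Pi>\<^sub>M e\<in>E. (lborel :: real measure))"
proof (cases "adj E i j")
  case True
  then have "(\<lambda>x. x (min i j, max i j)) \<in> measurable (\<Pi>\<^sub>M e\<in>E. (lborel :: real measure)) lborel"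
    by (intro measurable_component_singleton) (simp add: adj_def)
  then show ?thesis using True by (simp add: weights_def)
qed (simp add: weights_def)

lemma AE_nonsingular_on:
  assumes "finite E" "finite V" "weighting E A" "nonsingular_on V A"
  shows "AE x in (\<Pi>\<^sub>M e\<in>E. lborel). nonsingular_on V (weights E x)"
  unfolding nonsingular_on_iff_trivial_kernel
proof (rule AE_trivial_kernel)
  let ?a = "restrict (\<lambda>(i, j). A i j) E"
  show "?a \<in> space (\<Pi>\<^sub>M e\<in>E. (lborel :: real measure))" by (simp add: space_PiM)
  show "trivial_kernel V V (weights E ?a)"
    using assms by (simp add: weights_of_weighting nonsingular_on_iff_trivial_kernel)
qed (use assms in \<open>auto intro: coordinatewise_poly_weights measurable_weights\<close>)

lemma AE_rigid_on:
  assumes "finite E" "finite V" "weighting E A" "rigid_on V e A"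
  shows "AE x in (\<Pi>\<^sub>M e\<in>E. lborel). rigid_on V e (weights E x)"
  unfolding rigid_on_iff_trivial_kernel[OF assms(2)]
proof (rule AE_trivial_kernel)
  let ?a = "restrict (\<lambda>(i, j). A i j) E"
  let ?I = "{f. f \<subseteq> V \<and> card f = 2 \<and> f \<noteq> e}"
  let ?L = "\<lambda>A (i, j) f. \<Sum>k\<in>V. A i k * of_bool ({k, j} = f) - of_bool ({i, k} = f) * A k j"
  show "?a \<in> space (\<Pi>\<^sub>M e\<in>E. (lborel :: real measure))" by (simp add: space_PiM)
  show "trivial_kernel (V \<times> V) ?I (?L (weights E ?a))"
    using assms by (simp add: weights_of_weighting rigid_on_iff_trivial_kernel)
  show "finite ?I" using assms by (auto intro: finite_subset[of _ "Pow V"])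
  show "coordinatewise_poly E (\<lambda>x. ?L (weights E x) ij f)" for ij f
    by (cases ij) (auto intro!: coordinatewise_poly_intros coordinatewise_poly_weights)
  show "(\<lambda>x. ?L (weights E x) ij f) \<in> borel_measurable (\<Pi>\<^sub>M e\<in>E. (lborel :: real measure))" for ij f
    by (cases ij) (auto intro!: borel_measurable_sum borel_measurable_diff borel_measurable_times
        measurable_weights)
qed (use assms in auto)

lemma AE_PiM_lborel_ex:
  assumes "finite E" "AE x in (\<Pi>\<^sub>M e\<in>E. (lborel :: real measure)). P x"
  shows "\<exists>x. P x"
proof (rule ccontr)
  assume "\<nexists>x. P x"
  then have "AE x in (\<Pi>\<^sub>M e\<in>E. (lborel :: real measure)). False"
    using assms(2) by (auto elim: eventually_mono)
  then show False using not_AE_False_PiM_lborel[OF assms(1)] by blast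
qed

text \<open>The weighting may vanish on edges, which is how edges get discarded in the constructions
  below. For finite \<open>E\<close> and \<open>V\<close>, one good weighting exists if and only if
  almost all are good; existence is convenient to construct, the generic form to combine.\<close>

definition can_nonsingular :: "(nat \<times> nat) set \<Rightarrow> nat set \<Rightarrow> bool" where
  "can_nonsingular E V \<longleftrightarrow> (\<exists>A. weighting E A \<and> nonsingular_on V A)"

definition can_rigid :: "(nat \<times> nat) set \<Rightarrow> nat set \<Rightarrow> nat set \<Rightarrow> bool" where
  "can_rigid E V e \<longleftrightarrow> (\<exists>A. weighting E A \<and> rigid_on V e A)"

text \<open>Row and column \<open>z\<close> of \<open>A\<close> vanish, so the \<open>(i, z)\<close>
  entry of the commutation says that \<open>A\<close> restricted to \<open>V\<close> kills the
  column of \<open>B\<close> at \<open>z\<close>. Nonsingularity makes this column zero, and the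
  remaining entries are the commutation relation on \<open>V\<close>.\<close>

lemma rigid_on_insert:
  assumes V: "finite V" "z \<notin> V" and sym: "\<And>i j. A i j = A j i"
    and ns: "nonsingular_on V A" and rigid: "rigid_on V e A"
    and z: "\<And>i. i \<in> insert z V \<Longrightarrow> A i z = 0"
  shows "rigid_on (insert z V) e A"
  unfolding rigid_on_def
proof (intro allI impI, elim conjE)
  fix B
  assume B: "\<forall>i\<in>insert z V. \<forall>j\<in>insert z V. B i j = B j i" "\<forall>i\<in>insert z V. B i i = 0"
    "\<forall>i\<in>insert z V. \<forall>j\<in>insert z V. {i, j} = e \<longrightarrow> B i j = 0"
    and comm: "\<forall>i\<in>insert z V. \<forall>j\<in>insert z V.
      (\<Sum>k\<in>insert z V. A i k * B k j) = (\<Sum>k\<in>insert z V. B i k * A k j)"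
  have "(\<Sum>k\<in>V. A i k * B k z) = 0" if "i \<in> V" for i
    using comm[THEN bspec[of _ _ i], THEN bspec[of _ _ z]] that V z by simp
  then have Bz: "\<forall>k\<in>V. B k z = 0"
    using ns[unfolded nonsingular_on_def, THEN spec, of "\<lambda>k. B k z"] by blast
  have "\<forall>i\<in>V. \<forall>j\<in>V. (\<Sum>k\<in>V. A i k * B k j) = (\<Sum>k\<in>V. B i k * A k j)"
  proof (intro ballI)
    fix i j assume ij: "i \<in> V" "j \<in> V"
    then have "A i z = 0" "A z j = 0" using z sym by auto
    then show "(\<Sum>k\<in>V. A i k * B k j) = (\<Sum>k\<in>V. B i k * A k j)"
      using comm[THEN bspec[of _ _ i], THEN bspec[of _ _ j]] ij V by simp
  qed
  then have "\<forall>i\<in>V. \<forall>j\<in>V. B i j = 0"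
    using rigid[unfolded rigid_on_def, THEN spec, of B] B by blast
  then show "\<forall>i\<in>insert z V. \<forall>j\<in>insert z V. B i j = 0" using Bz B by auto
qed

lemma nonsingular_on_cong:
  assumes "\<And>i j. i \<in> V \<Longrightarrow> j \<in> V \<Longrightarrow> A i j = A' i j"
  shows "nonsingular_on V A \<longleftrightarrow> nonsingular_on V A'"
  using assms by (simp add: nonsingular_on_def)

lemma rigid_on_cong:
  assumes "\<And>i j. i \<in> V \<Longrightarrow> j \<in> V \<Longrightarrow> A i j = A' i j"
  shows "rigid_on V e A \<longleftrightarrow> rigid_on V e A'"
  using assms by (simp add: rigid_on_def)

text \<open>The weightings given for rigidity and for nonsingularity may differ. Both properties
  hold almost everywhere, so some point has both, and there the weights at \<open>z\<close> are set
  to 0.\<close>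

lemma can_rigid_insert:
  assumes E: "finite E" and V: "finite V" "z \<notin> V" and "can_rigid E V e" "can_nonsingular E V"
  shows "can_rigid E (insert z V) e"
proof -
  have "AE x in (\<Pi>\<^sub>M e\<in>E. lborel). rigid_on V e (weights E x)"
       "AE x in (\<Pi>\<^sub>M e\<in>E. lborel). nonsingular_on V (weights E x)"
    using assms by (auto simp: can_rigid_def can_nonsingular_def intro: AE_rigid_on AE_nonsingular_on)
  then have "AE x in (\<Pi>\<^sub>M e\<in>E. lborel). rigid_on V e (weights E x) \<and> nonsingular_on V (weights E x)"
    by eventually_elim auto
  then obtain x where x: "rigid_on V e (weights E x)" "nonsingular_on V (weights E x)"
    using AE_PiM_lborel_ex[OF E] by blast
  define A where "A i j = (if i = z \<or> j = z then 0 else weights E x i j)" for i j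
  have "weighting E A"
    using weighting_weights[of E x] by (auto simp: weighting_def A_def)
  moreover have "rigid_on (insert z V) e A"
  proof (rule rigid_on_insert)
    show "A i j = A j i" for i j using \<open>weighting E A\<close> by (simp add: weighting_def)
    have eq: "A i j = weights E x i j" if "i \<in> V" "j \<in> V" for i j
      using that V by (auto simp: A_def)
    show "nonsingular_on V A" using x(2) by (subst nonsingular_on_cong[OF eq])
    show "rigid_on V e A" using x(1) by (subst rigid_on_cong[OF eq])
  qed (use V in \<open>auto simp: A_def\<close>)
  ultimately show ?thesis by (auto simp: can_rigid_def)
qed

section \<open>Nonsingular weightings from matchings and odd cycles\<close>

lemma can_nonsingular_Un:
  assumes "finite V" "finite W" "V \<inter> W = {}" "can_nonsingular E V" "can_nonsingular E W"
  shows "can_nonsingular E (V \<union> W)"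
proof -
  obtain A B where A: "weighting E A" "nonsingular_on V A" and B: "weighting E B" "nonsingular_on W B"
    using assms by (auto simp: can_nonsingular_def)
  \<comment> \<open>Block diagonal: all weights between \<open>V\<close> and \<open>W\<close> are
    0.\<close>
  define C where "C i j = (if i \<in> V \<and> j \<in> V then A i j else if i \<in> W \<and> j \<in> W then B i j else 0)" for i j
  have "weighting E C" using A B by (auto simp: weighting_def C_def)
  moreover have "nonsingular_on (V \<union> W) C"
    unfolding nonsingular_on_def
  proof (intro allI impI)
    fix v assume v: "\<forall>i\<in>V \<union> W. (\<Sum>j\<in>V \<union> W. C i j * v j) = 0"
    have split: "(\<Sum>j\<in>V \<union> W. C i j * v j) = (\<Sum>j\<in>V. C i j * v j) + (\<Sum>j\<in>W. C i j * v j)" for i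
      using assms by (intro sum.union_disjoint) auto
    have "(\<Sum>j\<in>V. A i j * v j) = 0" if "i \<in> V" for i
    proof -
      have "(\<Sum>j\<in>W. C i j * v j) = 0"
        using that assms(3) by (intro sum.neutral) (auto simp: C_def)
      moreover have "(\<Sum>j\<in>V. C i j * v j) = (\<Sum>j\<in>V. A i j * v j)"
        using that by (intro sum.cong) (auto simp: C_def)
      ultimately show ?thesis using v split[of i] that by auto
    qed
    moreover have "(\<Sum>j\<in>W. B i j * v j) = 0" if "i \<in> W" for i
    proof -
      have "(\<Sum>j\<in>V. C i j * v j) = 0"
        using that assms(3) by (intro sum.neutral) (auto simp: C_def)
      moreover have "(\<Sum>j\<in>W. C i j * v j) = (\<Sum>j\<in>W. B i j * v j)"
        using that assms(3) by (intro sum.cong) (auto simp: C_def)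
      ultimately show ?thesis using v split[of i] that by auto
    qed
    ultimately show "\<forall>i\<in>V \<union> W. v i = 0"
      using A(2)[unfolded nonsingular_on_def, THEN spec, of v]
        B(2)[unfolded nonsingular_on_def, THEN spec, of v] by blast
  qed
  ultimately show ?thesis by (auto simp: can_nonsingular_def)
qed

lemma can_nonsingular_empty: "can_nonsingular E {}"
  by (auto simp: can_nonsingular_def nonsingular_on_def weighting_def intro: exI[of _ "\<lambda>_ _. 0"])

lemma can_nonsingular_edge:
  assumes "adj E u w"
  shows "can_nonsingular E {u, w}"
proof -
  define A :: "nat \<Rightarrow> nat \<Rightarrow> real" where "A i j = of_bool ({i, j} = {u, w})" for i j
  have uw: "u \<noteq> w" using assms by (simp add: adj_def)
  have "weighting E A"
    using assms by (auto simp: weighting_def A_def doubleton_eq_iff adj_commute)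
  moreover have "nonsingular_on {u, w} A"
    using uw by (auto simp: nonsingular_on_def A_def doubleton_eq_iff)
  ultimately show ?thesis by (auto simp: can_nonsingular_def)
qed

text \<open>Take the permutation matrix of \<open>\<sigma>\<close> plus its transpose. For
  \<open>v\<close> in the kernel, row \<open>\<sigma> i\<close> gives
  \<open>v (\<sigma> (\<sigma> i)) = - v i\<close>; iterating this \<open>n\<close> times returns to
  \<open>i\<close> with the sign \<open>(-1) ^ n = -1\<close>, so \<open>v i = 0\<close>.\<close>

lemma can_nonsingular_odd_permutation:
  assumes W: "finite W" and \<sigma>: "\<sigma> permutes W" and n: "odd n" "\<And>i. i \<in> W \<Longrightarrow> (\<sigma> ^^ n) i = i"
    and adj: "\<And>i. i \<in> W \<Longrightarrow> adj E i (\<sigma> i)"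
  shows "can_nonsingular E W"
proof -
  define A :: "nat \<Rightarrow> nat \<Rightarrow> real"
    where "A i j = of_bool (i \<in> W) * of_bool (j = \<sigma> i) + of_bool (j \<in> W) * of_bool (i = \<sigma> j)" for i j
  have "weighting E A"
    using adj by (auto simp: weighting_def A_def adj_commute)
  moreover have "nonsingular_on W A"
    unfolding nonsingular_on_def
  proof (intro allI impI)
    fix v assume v: "\<forall>i\<in>W. (\<Sum>j\<in>W. A i j * v j) = 0"
    have in_W: "\<sigma> i \<in> W \<longleftrightarrow> i \<in> W" for i using \<sigma> by (rule permutes_in_image)
    have step: "v (\<sigma> (\<sigma> i)) = - v i" if i: "i \<in> W" for i
    proof -
      have "0 = (\<Sum>j\<in>W. A (\<sigma> i) j * v j)" using v i in_W by simp
      also have "\<dots> = (\<Sum>j\<in>W. (if \<sigma> (\<sigma> i) = j then v j else 0) + (if i = j then v j else 0))"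
        using i permutes_inj[OF \<sigma>] by (intro sum.cong refl) (auto simp: A_def in_W inj_eq)
      also have "\<dots> = v (\<sigma> (\<sigma> i)) + v i"
        using i W in_W by (simp add: sum.distrib)
      finally show ?thesis by simp
    qed
    have "v ((\<sigma> ^^ (2 * m)) i) = (-1) ^ m * v i \<and> (\<sigma> ^^ (2 * m)) i \<in> W" if "i \<in> W" for m i
      using that by (induction m) (auto simp: step in_W)
    moreover have "(\<sigma> ^^ (2 * n)) i = i" if "i \<in> W" for i
      using n(2)[OF that] by (simp add: mult_2 funpow_add)
    ultimately have "v i = (-1) ^ n * v i" if "i \<in> W" for i
      using that by metis
    then show "\<forall>i\<in>W. v i = 0" using n(1) by auto
  qed
  ultimately show ?thesis by (auto simp: can_nonsingular_def)
qed

text \<open>Consecutive entries are paired off, and each pair is a nonsingular block.\<close>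

lemma can_nonsingular_even_list:
  assumes "even (length cs)" "distinct cs"
    and "\<And>k. Suc k < length cs \<Longrightarrow> adj E (cs ! k) (cs ! Suc k)"
  shows "can_nonsingular E (set cs)"
  using assms
proof (induction cs rule: induct_list012)
  case (3 x y zs)
  have "can_nonsingular E ({x, y} \<union> set zs)"
  proof (rule can_nonsingular_Un)
    show "can_nonsingular E {x, y}" using "3.prems"(3)[of 0] by (auto intro: can_nonsingular_edge)
    show "can_nonsingular E (set zs)"
      using "3.prems" "3.prems"(3)[of "Suc (Suc _)"] by (intro "3.IH") auto
  qed (use "3.prems" in auto)
  then show ?case by simp
qed (auto simp: can_nonsingular_empty)

text \<open>An odd cycle is kept whole. For even length, weights all equal to 1 may be singular
  (length 4, say), so every other edge is dropped and a perfect matching remains.\<close>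

lemma can_nonsingular_cycle:
  assumes "cycle cs" and adj: "\<And>i. i \<in> set cs \<Longrightarrow> adj E i (cycle_of_list cs i)"
  shows "can_nonsingular E (set cs)"
proof (cases "even (length cs)")
  case True
  have nth: "cycle_of_list cs (cs ! k) = cs ! Suc k" if "Suc k < length cs" for k
  proof -
    have "map (cycle_of_list cs) cs = rotate1 cs" using cyclic_rotation[OF assms(1), of 1] by simp
    then have "cycle_of_list cs (cs ! k) = rotate1 cs ! k" using that by (metis Suc_lessD nth_map)
    then show ?thesis using that by (simp add: nth_rotate1)
  qed
  then show ?thesis
    using assms True by (intro can_nonsingular_even_list) (auto simp flip: nth)
next
  case False
  have "map (cycle_of_list cs ^^ length cs) cs = cs"
    using cyclic_rotation[OF assms(1), of "length cs"] by simp
  then have "(cycle_of_list cs ^^ length cs) i = i" if "i \<in> set cs" for i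
    using that by (metis map_eq_conv map_ident)
  then show ?thesis
    using False adj by (intro can_nonsingular_odd_permutation[of _ "cycle_of_list cs"]) (auto intro: cycle_permutes)
qed

text \<open>The cycles of \<open>\<sigma>\<close> become diagonal blocks; fixed points cannot occur
  because \<open>adj\<close> is irreflexive.\<close>

lemma can_nonsingular_permutation:
  assumes "finite V" "\<sigma> permutes V" "\<And>i. i \<in> V \<Longrightarrow> adj E i (\<sigma> i)"
  shows "can_nonsingular E V"
proof -
  \<comment> \<open>The adjacency hypothesis stands inside the induction because the permutation
    grows by one cycle at each step.\<close>
  have "p permutes I \<and> finite I \<and> ((\<forall>i\<in>I. adj E i (p i)) \<longrightarrow> can_nonsingular E I)"
    if "cycle_decomp I p" for I and p :: "nat \<Rightarrow> nat"
    using that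
  proof induction
    case empty
    then show ?case by (auto simp: can_nonsingular_empty permutes_id)
  next
    case (comp I p cs)
    let ?c = "cycle_of_list cs"
    have p: "p permutes I" "finite I" using comp.IH by auto
    have perm: "?c \<circ> p permutes set cs \<union> I"
      using p cycle_permutes[of cs]
      by (intro permutes_compose) (auto elim: permutes_subset)
    have ns: "can_nonsingular E (set cs \<union> I)" if adj: "\<forall>i\<in>set cs \<union> I. adj E i ((?c \<circ> p) i)"
    proof (rule can_nonsingular_Un)
      show "can_nonsingular E (set cs)"
      proof (rule can_nonsingular_cycle[OF comp.hyps(2)])
        fix i assume i: "i \<in> set cs"
        then have "p i = i" using p comp.hyps by (meson disjoint_iff permutes_not_in)
        then show "adj E i (?c i)" using adj i by (metis Un_iff comp_apply)
      qed
      have "adj E i (p i)" if i: "i \<in> I" for i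
      proof -
        have "p i \<notin> set cs" using i p comp.hyps permutes_in_image[OF p(1)] by blast
        then have "?c (p i) = p i" by (rule id_outside_supp)
        then show ?thesis using adj i by (metis Un_iff comp_apply)
      qed
      then show "can_nonsingular E I" using comp.IH by blast
    qed (use comp.hyps p in auto)
    show ?case
      by (intro conjI impI perm) (use p(2) in simp, erule ns)
  qed
  from this[OF cycle_decomposition[OF assms(2,1)]] show ?thesis using assms by blast
qed

section \<open>Rigidity of a triangle followed by a path\<close>

lemma can_rigid_triangle:
  assumes "adj E x y" "adj E y z" "adj E x z"
  shows "can_rigid E {x, y, z} {x, y}"
proof -
  define A :: "nat \<Rightarrow> nat \<Rightarrow> real"
    where "A i j = of_bool (i \<noteq> j \<and> i \<in> {x, y, z} \<and> j \<in> {x, y, z})" for i j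
  have ne: "x \<noteq> y" "y \<noteq> z" "x \<noteq> z" using assms by (auto simp: adj_def)
  have A: "A x x = 0" "A y y = 0" "A z z = 0" "A x y = 1" "A y x = 1" "A x z = 1" "A z x = 1"
    "A y z = 1" "A z y = 1"
    using ne by (auto simp: A_def)
  have "weighting E A"
    using assms by (auto simp: weighting_def A_def adj_commute)
  moreover have "rigid_on {x, y, z} {x, y} A"
    unfolding rigid_on_def
  proof (intro allI impI, elim conjE)
    fix B
    assume sym: "\<forall>i\<in>{x, y, z}. \<forall>j\<in>{x, y, z}. B i j = B j i"
      and diag: "\<forall>i\<in>{x, y, z}. B i i = 0"
      and e: "\<forall>i\<in>{x, y, z}. \<forall>j\<in>{x, y, z}. {i, j} = {x, y} \<longrightarrow> B i j = 0"
      and comm: "\<forall>i\<in>{x, y, z}. \<forall>j\<in>{x, y, z}.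
        (\<Sum>k\<in>{x, y, z}. A i k * B k j) = (\<Sum>k\<in>{x, y, z}. B i k * A k j)"
    have S: "(\<Sum>k\<in>{x, y, z}. f k) = f x + f y + f z" for f :: "nat \<Rightarrow> real"
      using ne by simp
    have B: "B y x = B x y" "B z x = B x z" "B z y = B y z" "B x x = 0" "B y y = 0" "B z z = 0"
      "B x y = 0"
      using sym diag e by blast+
    \<comment> \<open>With all weights 1 and \<open>B x y = 0\<close>, only \<open>B x z\<close> and
      \<open>B y z\<close> are left; the entries \<open>(x, y)\<close> and \<open>(x, z)\<close> of
      the commutation dispose of them.\<close>
    have "B z y = B x z"
      using comm[THEN bspec[of _ _ x], THEN bspec[of _ _ y]] by (simp only: S A B) simp
    moreover have "B y z = 0"
      using comm[THEN bspec[of _ _ x], THEN bspec[of _ _ z]] by (simp only: S A B) simp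
    ultimately show "\<forall>i\<in>{x, y, z}. \<forall>j\<in>{x, y, z}. B i j = 0" by (simp add: B)
  qed
  ultimately show ?thesis by (auto simp: can_rigid_def)
qed

lemma can_nonsingular_triangle:
  assumes "adj E x y" "adj E y z" "adj E x z"
  shows "can_nonsingular E {x, y, z}"
proof -
  have "x \<noteq> y" "y \<noteq> z" "x \<noteq> z" using assms by (auto simp: adj_def)
  then have "can_nonsingular E (set [x, y, z])"
    using assms by (intro can_nonsingular_cycle) (auto simp: transpose_def adj_commute)
  then show ?thesis by simp
qed

text \<open>An even prefix is matched along the path. An odd one has no such matching, but its first
  three vertices form an odd cycle and leave an even path.\<close>

lemma can_nonsingular_take_kite:
  assumes P: "distinct P" "successively (adj E) P" and chord: "adj E (P ! 0) (P ! 2)"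
    and k: "3 \<le> k" "k \<le> length P"
  shows "can_nonsingular E (set (take k P))"
proof (cases "even k")
  case True
  then show ?thesis
    using P k by (intro can_nonsingular_even_list) (auto simp: successively_conv_nth)
next
  case False
  have eq: "take k P = [P ! 0, P ! 1, P ! 2] @ drop 3 (take k P)"
  proof -
    have "take 3 (take k P) = [P ! 0, P ! 1, P ! 2]"
      using k by (intro nth_equalityI) (auto simp: less_Suc_eq numeral_3_eq_3 numeral_2_eq_2)
    then show ?thesis by (metis append_take_drop_id)
  qed
  have "can_nonsingular E ({P ! 0, P ! 1, P ! 2} \<union> set (drop 3 (take k P)))"
  proof (rule can_nonsingular_Un)
    show "can_nonsingular E {P ! 0, P ! 1, P ! 2}"
      using P(2) chord k
      by (intro can_nonsingular_triangle) (auto simp: successively_conv_nth numeral_2_eq_2)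
    show "can_nonsingular E (set (drop 3 (take k P)))"
    proof (rule can_nonsingular_even_list)
      fix i assume "Suc i < length (drop 3 (take k P))"
      moreover from this have "adj E (P ! (3 + i)) (P ! Suc (3 + i))"
        using k by (intro P(2)[unfolded successively_conv_nth, rule_format]) simp
      ultimately show "adj E (drop 3 (take k P) ! i) (drop 3 (take k P) ! Suc i)"
        using k by simp
    qed (use P k False in auto)
    have "distinct ([P ! 0, P ! 1, P ! 2] @ drop 3 (take k P))" using P(1) by (metis eq distinct_take)
    then show "{P ! 0, P ! 1, P ! 2} \<inter> set (drop 3 (take k P)) = {}" by auto
  qed auto
  then show ?thesis by (subst eq) auto
qed

text \<open>Adding \<open>P ! k\<close> rests on nonsingularity of the prefix before it; the path
  edge at \<open>P ! k\<close> enters through nonsingularity of the longer prefixes.\<close>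

lemma can_rigid_kite:
  assumes E: "finite E" and P: "distinct P" "successively (adj E) P" and chord: "adj E (P ! 0) (P ! 2)"
    and k: "3 \<le> k" "k \<le> length P"
  shows "can_rigid E (set (take k P)) {P ! 0, P ! 1}"
  using k
proof (induction k rule: nat_induct_at_least)
  case base
  have "take 3 P = [P ! 0, P ! 1, P ! 2]"
    using base by (intro nth_equalityI) (auto simp: less_Suc_eq numeral_3_eq_3 numeral_2_eq_2)
  moreover have "can_rigid E {P ! 0, P ! 1, P ! 2} {P ! 0, P ! 1}"
    using P(2) chord base
    by (intro can_rigid_triangle) (auto simp: successively_conv_nth numeral_2_eq_2)
  ultimately show ?case by simp
next
  case (Suc k)
  have "can_rigid E (insert (P ! k) (set (take k P))) {P ! 0, P ! 1}"
  proof (rule can_rigid_insert[OF E])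
    show "P ! k \<notin> set (take k P)"
      using Suc.prems P(1) by (auto simp: in_set_conv_nth nth_eq_iff_index_eq)
    show "can_nonsingular E (set (take k P))"
      using Suc by (intro can_nonsingular_take_kite P chord) auto
  qed (use Suc in auto)
  then show ?case using Suc.prems by (simp add: take_Suc_conv_app_nth)
qed

text \<open>Beyond the path no order has to be chosen: every intermediate set lies between
  \<open>set P\<close> and \<open>U\<close>, where nonsingularity is assumed.\<close>

lemma can_rigid_of_kite:
  assumes E: "finite E" and P: "distinct P" "successively (adj E) P" "adj E (P ! 0) (P ! 2)" "3 \<le> length P"
    and U: "finite U" "set P \<subseteq> U"
    and ns: "\<And>V. set P \<subseteq> V \<Longrightarrow> V \<subseteq> U \<Longrightarrow> can_nonsingular E V"
  shows "can_rigid E U {P ! 0, P ! 1}"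
proof -
  have "can_rigid E (set P \<union> W) {P ! 0, P ! 1}" if "finite W" "W \<subseteq> U - set P" for W
    using that
  proof (induction W rule: finite_induct)
    case empty
    then show ?case using can_rigid_kite[OF E P(1-3), of "length P"] P(4) by simp
  next
    case (insert z W)
    have "can_rigid E (insert z (set P \<union> W)) {P ! 0, P ! 1}"
    proof (rule can_rigid_insert[OF E])
      show "can_nonsingular E (set P \<union> W)" using insert.prems U by (intro ns) auto
    qed (use insert in auto)
    then show ?case by simp
  qed
  from this[of "U - set P"] U show ?thesis by (simp add: Un_absorb1)
qed

section \<open>Transfer between weightings of a graph and matrices with given support\<close>

lemma free_entries_Supp: "free_entries (Supp G) = {(i, j). i \<le> j \<and> {i, j} \<in> G}"
  by (auto simp: free_entries_def Supp_def insert_commute)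

lemma Supp_subset:
  assumes "G \<subseteq> all_edges N"
  shows "Supp G \<subseteq> {..<N} \<times> {..<N}" "(i, i) \<notin> Supp G"
  using assms by (auto simp: Supp_def all_edges_def)

lemma finite_free_entries_Supp:
  assumes "G \<subseteq> all_edges N"
  shows "finite (free_entries (Supp G))"
proof (rule finite_subset)
  show "free_entries (Supp G) \<subseteq> {..<N} \<times> {..<N}"
    using Supp_subset[OF assms] by (auto simp: free_entries_def)
qed simp

lemma adj_free_entries_Supp:
  assumes "G \<subseteq> all_edges N"
  shows "adj (free_entries (Supp G)) i j \<longleftrightarrow> {i, j} \<in> G"
proof -
  have "{i, j} \<in> G \<Longrightarrow> i \<noteq> j" using assms by (auto simp: all_edges_def)
  then show ?thesis
    by (auto simp: adj_def free_entries_Supp min_def max_def insert_commute)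
qed

lemma AE_sym_lebesgue:
  assumes "S \<subseteq> {..<N} \<times> {..<N}"
  shows "(AE A in sym_lebesgue N S. P A) \<longleftrightarrow>
    (AE x in (\<Pi>\<^sub>M e\<in>free_entries S. lborel). P (mat_of_coords N S x))"
  unfolding sym_lebesgue_def
  using bij_betw_coords[OF assms] by (intro AE_embed_measure') (simp add: space_PiM bij_betw_def)

lemma mat_of_coords_index:
  assumes "G \<subseteq> all_edges N" "i < N" "j < N"
  shows "mat_of_coords N (Supp G) x $$ (i, j) = weights (free_entries (Supp G)) x i j"
  using assms Supp_subset(2)[OF assms(1), of i]
  by (auto simp: mat_of_coords_def weights_def adj_def free_entries_def)

lemma mat_mult_index_sum:
  assumes "A \<in> carrier_mat N N" "B \<in> carrier_mat N N" "i < N" "j < N"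
  shows "(A * B) $$ (i, j) = (\<Sum>k<N. A $$ (i, k) * B $$ (k, j))"
  using assms by (simp add: scalar_prod_def lessThan_atLeast0)

lemma sym_mats_index:
  assumes "B \<in> sym_mats N" "i < N" "j < N"
  shows "B $$ (i, j) = B $$ (j, i)"
proof -
  have "transpose_mat B $$ (j, i) = B $$ (i, j)"
    using assms by (intro index_transpose_mat(1)) (auto simp: sym_mats_def)
  then show ?thesis using assms by (auto simp: sym_mats_def)
qed

text \<open>Subtract from \<open>B\<close> the multiple of \<open>A\<close> that agrees with it at
  \<open>{u, w}\<close>; the difference satisfies the hypotheses of rigidity and vanishes. The
  multiple exists because the entry of \<open>A\<close> at the edge \<open>{u, w}\<close> is nonzero
  almost everywhere.\<close>

lemma diagonally_identifiable_if_can_rigid: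
  assumes G: "G \<subseteq> all_edges N" and rigid: "can_rigid (free_entries (Supp G)) {..<N} {u, w}"
    and uw: "{u, w} \<in> G"
  shows "diagonally_identifiable N (Supp G)"
proof -
  let ?E = "free_entries (Supp G)"
  have uwN: "u < N" "w < N" using uw G by (auto simp: all_edges_def)
  have E: "finite ?E" using G by (rule finite_free_entries_Supp)
  have "AE x in (\<Pi>\<^sub>M e\<in>?E. lborel). rigid_on {..<N} {u, w} (weights ?E x)"
    using rigid E by (auto simp: can_rigid_def intro: AE_rigid_on)
  moreover have "AE x in (\<Pi>\<^sub>M e\<in>?E. lborel). weights ?E x u w \<noteq> 0"
  proof (rule AE_coordinatewise_poly_nonzero[OF E coordinatewise_poly_weights measurable_weights])
    show "restrict (\<lambda>_. 1) ?E \<in> space (\<Pi>\<^sub>M e\<in>?E. (lborel :: real measure))" by (simp add: space_PiM)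
    show "weights ?E (restrict (\<lambda>_. 1) ?E) u w \<noteq> 0"
      using uw adj_free_entries_Supp[OF G, of u w] by (simp add: weights_def adj_def)
  qed
  ultimately have "AE x in (\<Pi>\<^sub>M e\<in>?E. lborel).
      \<forall>B\<in>sym_mats N. (\<forall>i<N. B $$ (i, i) = 0) \<and>
        mat_of_coords N (Supp G) x * B = B * mat_of_coords N (Supp G) x
        \<longrightarrow> (\<exists>c. B = c \<cdot>\<^sub>m mat_of_coords N (Supp G) x)"
  proof eventually_elim
    case (elim x)
    let ?A = "mat_of_coords N (Supp G) x" and ?a = "weights ?E x"
    have A: "?A \<in> carrier_mat N N" by (simp add: mat_of_coords_def)
    note ix = mat_of_coords_index[OF G]
    show ?case
    proof (intro ballI impI, elim conjE)
      fix B assume Bs: "B \<in> sym_mats N" and diag: "\<forall>i<N. B $$ (i, i) = 0" and comm: "?A * B = B * ?A"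
      have B: "B \<in> carrier_mat N N" using Bs by (simp add: sym_mats_def)
      define c where "c = B $$ (u, w) / ?a u w"
      define b where "b i j = B $$ (i, j) - c * ?a i j" for i j
      have "\<forall>i\<in>{..<N}. \<forall>j\<in>{..<N}. b i j = 0"
      proof (rule elim(1)[unfolded rigid_on_def, THEN spec, THEN mp], intro conjI ballI impI)
        have asym: "?a i j = ?a j i" for i j
          using weighting_weights by (simp add: weighting_def)
        fix i j assume ij: "i \<in> {..<N}" "j \<in> {..<N}"
        show "b i j = b j i" using ij sym_mats_index[OF Bs] asym by (simp add: b_def)
        show "b i i = 0" using ij diag by (simp add: b_def weights_def adj_def)
        show "b i j = 0" if "{i, j} = {u, w}"
        proof -
          have "b u w = 0" using elim(2) by (simp add: b_def c_def)
          moreover have "b w u = b u w"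
            using uwN sym_mats_index[OF Bs] asym by (simp add: b_def)
          ultimately show ?thesis using that by (auto simp: doubleton_eq_iff)
        qed
        have "(\<Sum>k<N. ?a i k * B $$ (k, j)) = (?A * B) $$ (i, j)"
          using mat_mult_index_sum[OF A B, of i j] ij by (simp add: ix)
        also have "\<dots> = (\<Sum>k<N. B $$ (i, k) * ?a k j)"
          using mat_mult_index_sum[OF B A, of i j] ij by (simp add: ix comm)
        finally have "(\<Sum>k<N. ?a i k * B $$ (k, j)) = (\<Sum>k<N. B $$ (i, k) * ?a k j)" .
        then show "(\<Sum>k<N. ?a i k * b k j) = (\<Sum>k<N. b i k * ?a k j)"
          by (simp add: b_def algebra_simps sum_subtractf)
      qed
      then have "B = c \<cdot>\<^sub>m ?A"
        using A B by (intro eq_matI) (auto simp: b_def ix)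
      then show "\<exists>c. B = c \<cdot>\<^sub>m ?A" by blast
    qed
  qed
  then show ?thesis
    unfolding diagonally_identifiable_def AE_sym_lebesgue[OF Supp_subset(1)[OF G]]
    using Supp_subset[OF G] by blast
qed

text \<open>The counterexample works at every \<open>x\<close>: both products are zero, while
  \<open>A\<close> vanishes at \<open>(u, w)\<close>. Hence a single point taken from the
  almost-everywhere statement gives the contradiction.\<close>

lemma not_diagonally_identifiable_if_isolated:
  assumes G: "G \<subseteq> all_edges N" and uw: "u < N" "w < N" "u \<noteq> w"
    and iso: "\<And>e. e \<in> G \<Longrightarrow> u \<notin> e" "\<And>e. e \<in> G \<Longrightarrow> w \<notin> e"
  shows "\<not> diagonally_identifiable N (Supp G)"
proof
  let ?E = "free_entries (Supp G)"
  assume "diagonally_identifiable N (Supp G)"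
  then have "AE x in (\<Pi>\<^sub>M e\<in>?E. (lborel :: real measure)).
      \<forall>B\<in>sym_mats N. (\<forall>i<N. B $$ (i, i) = 0) \<and>
        mat_of_coords N (Supp G) x * B = B * mat_of_coords N (Supp G) x
        \<longrightarrow> (\<exists>c. B = c \<cdot>\<^sub>m mat_of_coords N (Supp G) x)"
    unfolding diagonally_identifiable_def AE_sym_lebesgue[OF Supp_subset(1)[OF G]] by blast
  then obtain x where x: "\<forall>B\<in>sym_mats N. (\<forall>i<N. B $$ (i, i) = 0) \<and>
        mat_of_coords N (Supp G) x * B = B * mat_of_coords N (Supp G) x
        \<longrightarrow> (\<exists>c. B = c \<cdot>\<^sub>m mat_of_coords N (Supp G) x)"
    using AE_PiM_lborel_ex[OF finite_free_entries_Supp[OF G]] by blast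
  let ?A = "mat_of_coords N (Supp G) x"
  define B :: "real mat" where "B = mat N N (\<lambda>(i, j). of_bool ({i, j} = {u, w}))"
  have A: "?A \<in> carrier_mat N N" by (simp add: mat_of_coords_def)
  have B: "B \<in> carrier_mat N N" by (simp add: B_def)
  have A0: "?A $$ (i, j) = 0" if "i < N" "j < N" "i \<in> {u, w} \<or> j \<in> {u, w}" for i j
  proof -
    have "{i, j} \<notin> G" using iso that(3) by auto
    then show ?thesis using that mat_of_coords_index[OF G] adj_free_entries_Supp[OF G]
      by (simp add: weights_def)
  qed
  have B0: "B $$ (i, j) = 0" if "i < N" "j < N" "i \<notin> {u, w} \<or> j \<notin> {u, w}" for i j
    using that by (auto simp: B_def doubleton_eq_iff)
  have "B \<in> sym_mats N"
    by (auto simp: B_def sym_mats_def insert_commute intro!: eq_matI)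
  moreover have "\<forall>i<N. B $$ (i, i) = 0" using uw by (auto simp: B_def doubleton_eq_iff)
  moreover have "?A * B = B * ?A"
  proof (rule eq_matI)
    fix i j assume "i < dim_row (B * ?A)" "j < dim_col (B * ?A)"
    then have ij: "i < N" "j < N" using A B by auto
    have "(?A * B) $$ (i, j) = 0"
      unfolding mat_mult_index_sum[OF A B ij]
      using A0[of i] B0[of _ j] ij by (intro sum.neutral) (metis lessThan_iff mult_eq_0_iff)
    moreover have "(B * ?A) $$ (i, j) = 0"
      unfolding mat_mult_index_sum[OF B A ij]
      using A0[of _ j] B0[of i] ij by (intro sum.neutral) (metis lessThan_iff mult_eq_0_iff)
    ultimately show "(?A * B) $$ (i, j) = (B * ?A) $$ (i, j)" by simp
  qed (use A B in auto)
  ultimately obtain c where c: "B = c \<cdot>\<^sub>m ?A" using x by blast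
  have "B $$ (u, w) = c * ?A $$ (u, w)" using c A uw by simp
  then show False using A0[of u w] uw by (simp add: B_def)
qed

section \<open>Long paths and expansion\<close>

definition edges_between :: "nat set \<Rightarrow> nat set \<Rightarrow> nat set set" where
  "edges_between S T = {e. \<exists>s\<in>S. \<exists>t\<in>T. s \<noteq> t \<and> e = {s, t}}"

text \<open>Absence of bipartite holes with both sides of size \<open>b\<close>. It serves twice:
  for the length of the path and for Hall's condition on large sets.\<close>

definition joined :: "nat \<Rightarrow> nat \<Rightarrow> nat set set \<Rightarrow> bool" where
  "joined N b G \<longleftrightarrow> (\<forall>X Y. X \<subseteq> {..<N} \<longrightarrow> Y \<subseteq> {..<N} \<longrightarrow> X \<inter> Y = {} \<longrightarrow> card X = b \<longrightarrow> card Y = b \<longrightarrow>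
     G \<inter> edges_between X Y \<noteq> {})"

text \<open>\<open>S\<close> and \<open>T\<close> may overlap, and an edge inside the overlap stands
  for two ordered pairs; hence the factor 2. Equal sizes leave one parameter for the union
  bound.\<close>

definition locally_sparse :: "nat \<Rightarrow> nat \<Rightarrow> real \<Rightarrow> nat set set \<Rightarrow> bool" where
  "locally_sparse N m d G \<longleftrightarrow> (\<forall>S T. S \<subseteq> {..<N} \<longrightarrow> T \<subseteq> {..<N} \<longrightarrow> S \<noteq> {} \<longrightarrow> card S < m \<longrightarrow> card T = card S \<longrightarrow>
     2 * real (card (G \<inter> edges_between S T)) < real (card S) * d)"

lemma joined_mono:
  assumes "joined N b K" "K \<subseteq> G"
  shows "joined N b G"
  unfolding joined_def
proof (intro allI impI)
  fix X Y :: "nat set"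
  assume "X \<subseteq> {..<N}" "Y \<subseteq> {..<N}" "X \<inter> Y = {}" "card X = b" "card Y = b"
  then have "K \<inter> edges_between X Y \<noteq> {}" using assms(1) by (simp add: joined_def)
  then show "G \<inter> edges_between X Y \<noteq> {}" using assms(2) by blast
qed

lemma joinedD:
  assumes "joined N b G" "X \<subseteq> {..<N}" "Y \<subseteq> {..<N}" "X \<inter> Y = {}" "b \<le> card X" "b \<le> card Y"
  shows "\<exists>x\<in>X. \<exists>y\<in>Y. {x, y} \<in> G"
proof -
  obtain X' where X': "X' \<subseteq> X" "card X' = b" using assms(5) by (meson obtain_subset_with_card_n)
  obtain Y' where Y': "Y' \<subseteq> Y" "card Y' = b" using assms(6) by (meson obtain_subset_with_card_n)
  have "G \<inter> edges_between X' Y' \<noteq> {}"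
    using assms(1)[unfolded joined_def, THEN spec, of X', THEN spec, of Y'] X' Y' assms(2-4) by blast
  then show ?thesis using X' Y' unfolding edges_between_def by blast
qed

text \<open>
  Depth-first search with the visited set \<open>F\<close>, the stack \<open>P\<close> and the unvisited set \<open>U\<close>: each step
  increases \<open>card F - card U\<close> by one and keeps \<open>P\<close> a path with no edge between \<open>F\<close> and \<open>U\<close>. The
  state with \<open>card F = card U\<close> has a long stack.
\<close>

lemma joined_imp_long_path:
  assumes G: "joined N b G"
  shows "\<exists>P. distinct P \<and> set P \<subseteq> {..<N} \<and> successively (\<lambda>x y. {x, y} \<in> G) P \<and> N \<le> length P + 2 * b"
proof -
  let ?R = "\<lambda>x y. {x, y} \<in> G"
  let ?state = "\<lambda>k F P U. F \<union> set P \<union> U = {..<N} \<and> F \<inter> set P = {} \<and> F \<inter> U = {} \<and> set P \<inter> U = {} \<and>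
      distinct P \<and> successively ?R P \<and> (\<forall>x\<in>F. \<forall>y\<in>U. {x, y} \<notin> G) \<and> card F + N = card U + k"
  have "\<exists>F P U. ?state k F P U"
    if "k \<le> N" for k
    using that
  proof (induction k)
    case 0
    have st: "?state 0 {} [] {..<N}" by auto
    show ?case by (intro exI) (rule st)
  next
    case (Suc k)
    then obtain F P U where part: "F \<union> set P \<union> U = {..<N}" "F \<inter> set P = {}" "F \<inter> U = {}" "set P \<inter> U = {}"
      and path: "distinct P" "successively ?R P" and none: "\<forall>x\<in>F. \<forall>y\<in>U. {x, y} \<notin> G"
      and card: "card F + N = card U + k"
      by auto
    have fin: "finite F" "finite U"
      using part(1) by (metis finite_Un finite_lessThan)+
    consider u where "P = []" "u \<in> U" | x xs u where "P = x # xs" "u \<in> U" "{x, u} \<in> G"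
      | x xs where "P = x # xs" "\<forall>u\<in>U. {x, u} \<notin> G" | "P = []" "U = {}"
      by (cases P) auto
    then show ?case
    proof cases
      case (1 u)
      have "card (U - {u}) + 1 = card U" using 1 fin by (metis Suc_eq_plus1 card.remove)
      then have st: "?state (Suc k) F [u] (U - {u})" using 1 part path none card by auto
      show ?thesis by (intro exI) (rule st)
    next
      case (2 x xs u)
      have "card (U - {u}) + 1 = card U" using 2 fin by (metis Suc_eq_plus1 card.remove)
      moreover have "{u, x} \<in> G" using 2(3) by (simp add: insert_commute)
      moreover have "F \<union> set (u # P) \<union> (U - {u}) = {..<N}" using part(1) 2(2) by auto
      moreover have "u \<notin> F" "u \<notin> set P" using part 2(2) by blast+
      ultimately have st: "?state (Suc k) F (u # P) (U - {u})"
        using 2(1) part(2-4) path none card by auto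
      show ?thesis by (intro exI) (rule st)
    next
      case (3 x xs)
      have "successively ?R xs" using path 3 by (cases xs) auto
      then have st: "?state (Suc k) (insert x F) xs U" using 3 part path none card fin by auto
      show ?thesis by (intro exI) (rule st)
    next
      case 4
      then have "card F = N" using part by simp
      then show ?thesis using card 4 Suc.prems by simp
    qed
  qed
  from this[of N] obtain F P U where part: "F \<union> set P \<union> U = {..<N}" "F \<inter> set P = {}" "F \<inter> U = {}" "set P \<inter> U = {}"
      and path: "distinct P" "successively ?R P" and none: "\<forall>x\<in>F. \<forall>y\<in>U. {x, y} \<notin> G"
      and card: "card F = card U"
    by auto
  have fin: "finite F" "finite U"
    using part(1) by (metis finite_Un finite_lessThan)+
  \<comment> \<open>\<open>F\<close> and \<open>U\<close> have equal size and no edge between them,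
    so each has at most \<open>b\<close> elements and the path misses at most \<open>2 * b\<close>
    vertices.\<close>
  have "card F \<le> b"
  proof (rule ccontr)
    assume "\<not> card F \<le> b"
    then have "\<exists>x\<in>F. \<exists>y\<in>U. {x, y} \<in> G"
      using part card by (intro joinedD[OF G]) auto
    then show False using none by blast
  qed
  moreover have "N = card F + length P + card U"
  proof -
    have "N = card (F \<union> set P \<union> U)" using part(1) by simp
    also have "\<dots> = card (F \<union> set P) + card U" using part fin by (intro card_Un_disjoint) auto
    also have "card (F \<union> set P) = card F + card (set P)" using part fin by (intro card_Un_disjoint) auto
    finally show ?thesis using path(1) by (simp add: distinct_card)
  qed
  ultimately show ?thesis
    using part path card by (intro exI[of _ P]) auto
qed

section \<open>Hall's condition from local sparsity and edges between large sets\<close>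

lemma ordered_pairs_of_doubleton: "{(s, t). {s, t} = {a, b}} = {(a, b), (b, a)}"
  by (auto simp: doubleton_eq_iff)

text \<open>Double counting. A neighbourhood smaller than \<open>T\<close> would lie in some
  \<open>T'\<close> of the same size as \<open>T\<close>. Each vertex of \<open>T\<close> has at
  least \<open>d\<close> edges into \<open>C\<close>, all ending in \<open>T'\<close>, which forces
  at least \<open>card T * d / 2\<close> edges between \<open>T\<close> and \<open>T'\<close>,
  contrary to local sparsity.\<close>

lemma expansion_of_locally_sparse:
  assumes H: "H \<subseteq> all_edges N" and sparse: "locally_sparse N m d H"
    and deg: "\<And>v. v \<in> T \<Longrightarrow> d \<le> card (H \<inter> edges_between {v} C)"
    and C: "C \<subseteq> V" "V \<subseteq> {..<N}" and T: "T \<subseteq> {..<N}" "card T < m"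
  shows "card T \<le> card (\<Union>s\<in>T. {t\<in>V. {s, t} \<in> H})"
proof (rule ccontr)
  let ?N = "\<Union>s\<in>T. {t\<in>V. {s, t} \<in> H}"
  assume "\<not> card T \<le> card ?N"
  then have less: "card ?N < card T" by simp
  have finT: "finite T" and finV: "finite V" using T C by (auto intro: finite_subset)
  have Nsub: "?N \<subseteq> {..<N}" using C by auto
  have "card T \<le> card {..<N}" using T by (intro card_mono) auto
  then obtain T' where T': "?N \<subseteq> T'" "T' \<subseteq> {..<N}" "card T' = card T"
    using exists_subset_between[of ?N "card T" "{..<N}"] less Nsub by (auto simp: less_imp_le)
  have finT': "finite T'" using T' by (auto intro: finite_subset)
  define F where "F = H \<inter> edges_between T T'"
  define Q where "Q = {(s, t). s \<in> T \<and> t \<in> T' \<and> {s, t} \<in> H}"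
  have finF: "finite F"
  proof (rule finite_subset)
    show "F \<subseteq> (\<lambda>(s, t). {s, t}) ` (T \<times> T')" by (auto simp: F_def edges_between_def)
  qed (use finT finT' in auto)
  have "card Q \<le> card (\<Union>e\<in>F. {(s, t). {s, t} = e})"
  proof (rule card_mono)
    show "finite (\<Union>e\<in>F. {(s, t). {s, t} = e})"
    proof (intro finite_UN_I finF)
      fix e assume "e \<in> F"
      then obtain a b where "e = {a, b}" by (auto simp: F_def edges_between_def)
      then show "finite {(s, t). {s, t} = e}" by (simp only: ordered_pairs_of_doubleton) simp
    qed
    have "s \<noteq> t" if "{s, t} \<in> H" for s t using that H by (auto simp: all_edges_def)
    then show "Q \<subseteq> (\<Union>e\<in>F. {(s, t). {s, t} = e})"
      unfolding Q_def F_def edges_between_def by blast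
  qed
  also have "\<dots> \<le> (\<Sum>e\<in>F. card {(s, t). {s, t} = e})" by (rule card_UN_le[OF finF])
  also have "\<dots> \<le> (\<Sum>e\<in>F. 2)"
  proof (rule sum_mono)
    fix e assume "e \<in> F"
    then obtain a b where e: "e = {a, b}" by (auto simp: F_def edges_between_def)
    show "card {(s, t). {s, t} = e} \<le> 2"
      unfolding e ordered_pairs_of_doubleton by (rule card_insert_le_m1) simp_all
  qed
  finally have upper: "card Q \<le> 2 * card F" by simp
  have "card T * d = (\<Sum>s\<in>T. d)" by simp
  also have "\<dots> \<le> (\<Sum>s\<in>T. real (card {t \<in> T'. {s, t} \<in> H}))"
  proof (rule sum_mono)
    fix s assume s: "s \<in> T"
    have "card (H \<inter> edges_between {s} C) \<le> card ((\<lambda>t. {s, t}) ` {t \<in> T'. {s, t} \<in> H})"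
    proof (rule card_mono)
      show "H \<inter> edges_between {s} C \<subseteq> (\<lambda>t. {s, t}) ` {t \<in> T'. {s, t} \<in> H}"
      proof
        fix e assume "e \<in> H \<inter> edges_between {s} C"
        then obtain t where t: "t \<in> C" "e = {s, t}" "{s, t} \<in> H" by (auto simp: edges_between_def)
        then have "t \<in> T'" using s C T'(1) by blast
        then show "e \<in> (\<lambda>t. {s, t}) ` {t \<in> T'. {s, t} \<in> H}" using t by blast
      qed
    qed (use finT' in auto)
    also have "\<dots> \<le> card {t \<in> T'. {s, t} \<in> H}" using finT' by (intro card_image_le) auto
    finally show "d \<le> real (card {t \<in> T'. {s, t} \<in> H})" using deg[OF s] by simp
  qed
  also have "\<dots> = real (card Q)"
  proof -
    have "Q = (SIGMA s:T. {t \<in> T'. {s, t} \<in> H})" by (auto simp: Q_def)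
    then show ?thesis using finT finT' by (simp add: card_SigmaI)
  qed
  finally have "card T * d \<le> 2 * real (card F)" using upper by simp
  moreover have "2 * real (card F) < card T * d"
    unfolding F_def
    using sparse[unfolded locally_sparse_def, THEN spec, of T, THEN spec, of T'] T T' less by fastforce
  ultimately show False by simp
qed

text \<open>Sets of size below \<open>2 * b\<close> expand by sparsity. If a larger \<open>S\<close>
  violates Hall's condition, let \<open>X\<close> be the part of \<open>V\<close> without neighbours
  in \<open>S\<close>. A small \<open>X\<close> would expand into \<open>V - S\<close>, which gives
  back the inequality for \<open>S\<close>. So both have size at least \<open>2 * b\<close> and no
  edge joins them, which \<open>joined\<close> forbids.\<close>

lemma can_nonsingular_of_expansion:
  assumes G: "G \<subseteq> all_edges N" "H \<subseteq> G" and joined: "joined N b G"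
    and sparse: "locally_sparse N (2 * b) d H"
    and deg: "\<And>v. v < N \<Longrightarrow> d \<le> card (H \<inter> edges_between {v} C)"
    and C: "C \<subseteq> V" "V \<subseteq> {..<N}"
  shows "can_nonsingular (free_entries (Supp G)) V"
proof -
  let ?A = "\<lambda>i. {j\<in>V. {i, j} \<in> G}"
  have finV: "finite V" using C by (auto intro: finite_subset)
  have small: "card T \<le> card (\<Union>s\<in>T. ?A s)" if "T \<subseteq> V" "card T < 2 * b" for T
  proof -
    have "card T \<le> card (\<Union>s\<in>T. {t\<in>V. {s, t} \<in> H})"
      using that G C by (intro expansion_of_locally_sparse[OF _ sparse deg]) auto
    also have "\<dots> \<le> card (\<Union>s\<in>T. ?A s)"
      using G(2) finV by (intro card_mono) (auto intro: finite_subset)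
    finally show ?thesis .
  qed
  have hall: "card S \<le> card (\<Union>i\<in>S. ?A i)" if S: "S \<subseteq> V" for S
  proof (rule ccontr)
    assume not: "\<not> card S \<le> card (\<Union>i\<in>S. ?A i)"
    define X where "X = V - (\<Union>i\<in>S. ?A i)"
    have finS: "finite S" using S finV by (rule finite_subset)
    have no_edge: "{s, x} \<notin> G" if "s \<in> S" "x \<in> X" for s x using that by (auto simp: X_def)
    have X: "card X = card V - card (\<Union>i\<in>S. ?A i)"
      unfolding X_def using finV by (intro card_Diff_subset) (auto intro: finite_subset)
    have "2 * b \<le> card S" using small[OF S] not by force
    moreover have "2 * b \<le> card X"
    proof (rule ccontr)
      assume "\<not> 2 * b \<le> card X"
      then have "card X \<le> card (\<Union>i\<in>X. ?A i)" by (intro small) (auto simp: X_def)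
      also have "\<dots> \<le> card (V - S)"
        using finV no_edge by (intro card_mono) (auto simp: insert_commute)
      also have "\<dots> = card V - card S" using S finS by (intro card_Diff_subset) auto
      finally show False
        using X not card_mono[OF finV S] by linarith
    qed
    moreover have "card S \<le> card V" using S finV by (rule card_mono[rotated])
    \<comment> \<open>\<open>S\<close> and \<open>X\<close> may overlap; removing \<open>b\<close>
      elements of \<open>S\<close> from \<open>X\<close> leaves at least \<open>b\<close>, which is
      why the size bound is \<open>2 * b\<close>.\<close>
    ultimately obtain S' where S': "S' \<subseteq> S" "card S' = b"
      using obtain_subset_with_card_n[of b S] by auto
    have "card X - card S' \<le> card (X - S')" by (rule diff_card_le_card_Diff) (use S' finS in \<open>auto intro: finite_subset\<close>)
    then have "b \<le> card (X - S')" using \<open>2 * b \<le> card X\<close> S'(2) by linarith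
    then have "\<exists>x\<in>S'. \<exists>y\<in>X - S'. {x, y} \<in> G"
      using S' S C by (intro joinedD[OF joined]) (auto simp: X_def)
    then show False using no_edge S' by blast
  qed
  obtain \<sigma> where \<sigma>: "\<sigma> permutes V" "\<And>i. i \<in> V \<Longrightarrow> \<sigma> i \<in> ?A i"
    using Hall_permutation[of V ?A] finV hall by auto
  show ?thesis
    using \<sigma> finV adj_free_entries_Supp[OF G(1)] by (intro can_nonsingular_permutation[of V \<sigma>]) auto
qed

text \<open>The position \<open>i\<close> of the chord depends on \<open>H\<close>, so degrees are
  counted into \<open>drop h P\<close>, which lies in the tail from the triangle on for every
  \<open>i < h\<close>.\<close>

lemma diagonally_identifiable_of_layers:
  assumes G: "G \<subseteq> all_edges N" "H \<subseteq> G" "K \<subseteq> G" and joined: "joined N b K"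
    and P: "distinct P" "set P \<subseteq> {..<N}" "successively (\<lambda>x y. {x, y} \<in> K) P"
    and chord: "i < h" "h + 2 < length P" "{P ! i, P ! (i + 2)} \<in> H"
    and sparse: "locally_sparse N (2 * b) d H"
    and deg: "\<And>v. v < N \<Longrightarrow> d \<le> card (H \<inter> edges_between {v} (set (drop h P)))"
  shows "diagonally_identifiable N (Supp G)"
proof -
  let ?E = "free_entries (Supp G)" and ?P = "drop i P"
  note adj = adj_free_entries_Supp[OF G(1)]
  have "joined N b G" using joined G(3) by (rule joined_mono)
  have R: "{P ! k, P ! Suc k} \<in> G" if "Suc k < length P" for k
    using P(3) G(3) that unfolding successively_conv_nth by blast
  have "can_rigid ?E {..<N} {?P ! 0, ?P ! 1}"
  proof (rule can_rigid_of_kite)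
    show "finite ?E" using G(1) by (rule finite_free_entries_Supp)
    show "successively (adj ?E) ?P"
      unfolding successively_conv_nth adj using R chord by auto
    show "adj ?E (?P ! 0) (?P ! 2)" using chord G(2) by (auto simp: adj)
    show "set ?P \<subseteq> {..<N}" using P(2) set_drop_subset[of i P] by blast
    fix V assume V: "set ?P \<subseteq> V" "V \<subseteq> {..<N}"
    have "set (drop h P) \<subseteq> V"
      using V(1) chord(1) set_drop_subset_set_drop[of i h P] by auto
    then show "can_nonsingular ?E V"
      using V by (intro can_nonsingular_of_expansion[OF G(1,2) \<open>joined N b G\<close> sparse deg])
  qed (use P chord in auto)
  moreover have "{?P ! 0, ?P ! 1} \<in> G" using R[of i] chord by simp
  ultimately show ?thesis using G(1) by (intro diagonally_identifiable_if_can_rigid)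
qed

section \<open>Concentration in the random graph\<close>

lemma finite_all_edges: "finite (all_edges N)"
  by (rule finite_subset[of _ "Pow {..<N}"]) (auto simp: all_edges_def)

lemma set_erdos_renyi: "set_pmf (erdos_renyi N p) \<subseteq> Pow (all_edges N)"
  by (auto simp: erdos_renyi_def)

lemma integrable_erdos_renyi: "integrable (measure_pmf (erdos_renyi N p)) (f :: _ \<Rightarrow> real)"
  by (intro integrable_measure_pmf_finite finite_subset[OF set_erdos_renyi]) (simp add: finite_all_edges)

lemma bernoulli_pmf_disj:
  assumes "0 \<le> a" "a \<le> 1" "0 \<le> b" "b \<le> 1"
  shows "bernoulli_pmf (a + b - a * b) =
    bernoulli_pmf a \<bind> (\<lambda>x. bernoulli_pmf b \<bind> (\<lambda>y. return_pmf (x \<or> y)))"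
proof (rule pmf_eqI)
  fix i
  have "a * b \<le> 1 * b" using assms by (intro mult_right_mono) auto
  moreover have "0 \<le> (1 - a) * (1 - b)" using assms by simp
  ultimately have ab: "0 \<le> a + b - a * b" "a + b - a * b \<le> 1"
    using assms by (auto simp: algebra_simps)
  show "pmf (bernoulli_pmf (a + b - a * b)) i =
      pmf (bernoulli_pmf a \<bind> (\<lambda>x. bernoulli_pmf b \<bind> (\<lambda>y. return_pmf (x \<or> y)))) i"
    using assms ab by (cases i) (simp_all add: pmf_bind algebra_simps)
qed

text \<open>An edge is missing from both independent layers with probability
  \<open>(1 - a) * (1 - b)\<close>, which is \<open>1 - (a + b - a * b)\<close>.\<close>

lemma erdos_renyi_Un:
  assumes "0 \<le> a" "a \<le> 1" "0 \<le> b" "b \<le> 1"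
  shows "erdos_renyi N (a + b - a * b) =
    map_pmf (\<lambda>(G, H). G \<union> H) (pair_pmf (erdos_renyi N a) (erdos_renyi N b))"
proof -
  let ?A = "all_edges N"
  let ?P = "\<lambda>p. Pi_pmf ?A False (\<lambda>_. bernoulli_pmf p)"
  have fin: "finite ?A" by (rule finite_all_edges)
  have "?P (a + b - a * b) =
      ?P a \<bind> (\<lambda>f. Pi_pmf ?A False (\<lambda>e. bernoulli_pmf b \<bind> (\<lambda>y. return_pmf (f e \<or> y))))"
    unfolding bernoulli_pmf_disj[OF assms] by (subst Pi_pmf_bind[OF fin, where d' = False]) simp
  also have "\<dots> = ?P a \<bind> (\<lambda>f. ?P b \<bind> (\<lambda>g. return_pmf (\<lambda>e. e \<in> ?A \<and> (f e \<or> g e))))"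
    using fin
    by (subst Pi_pmf_bind[OF fin, where d' = False])
       (auto intro!: bind_pmf_cong arg_cong[of _ _ return_pmf])
  finally have "erdos_renyi N (a + b - a * b) =
      ?P a \<bind> (\<lambda>f. ?P b \<bind> (\<lambda>g. return_pmf {e \<in> ?A. f e \<or> g e}))"
    by (simp add: erdos_renyi_def map_bind_pmf)
  also have "\<dots> = map_pmf (\<lambda>(G, H). G \<union> H) (pair_pmf (erdos_renyi N a) (erdos_renyi N b))"
    unfolding erdos_renyi_def pair_pmf_def
    by (simp add: map_bind_pmf bind_map_pmf map_pmf_def bind_assoc_pmf bind_return_pmf Collect_disj_eq conj_disj_distribL)
  finally show ?thesis .
qed

text \<open>Generating function of a binomial variable. The probability of missing \<open>F\<close>
  (\<open>z = 0\<close>) and the two Chernoff bounds (\<open>z = exp t\<close> and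
  \<open>z = exp (- t)\<close>) are read off from it.\<close>

lemma expectation_erdos_renyi_power:
  assumes p: "0 \<le> p" "p \<le> 1" and z: "0 \<le> z" and F: "F \<subseteq> all_edges N"
  shows "measure_pmf.expectation (erdos_renyi N p) (\<lambda>G. z ^ card (G \<inter> F)) = (1 - p + p * z) ^ card F"
proof -
  let ?A = "all_edges N"
  have fin: "finite ?A" by (rule finite_all_edges)
  have power: "z ^ card ({e \<in> ?A. f e} \<inter> F) = (\<Prod>e\<in>?A. if e \<in> F \<and> f e then z else 1)" for f
  proof -
    have "(\<Prod>e\<in>?A. if e \<in> F \<and> f e then z else 1) = (\<Prod>e\<in>{e \<in> ?A. e \<in> F \<and> f e}. z)"
      by (rule prod.inter_filter[OF fin, symmetric])
    also have "{e \<in> ?A. e \<in> F \<and> f e} = {e \<in> ?A. f e} \<inter> F" by auto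
    finally show ?thesis by simp
  qed
  have "measure_pmf.expectation (erdos_renyi N p) (\<lambda>G. z ^ card (G \<inter> F)) =
      measure_pmf.expectation (Pi_pmf ?A False (\<lambda>_. bernoulli_pmf p))
        (\<lambda>f. \<Prod>e\<in>?A. if e \<in> F \<and> f e then z else 1)"
    unfolding erdos_renyi_def by (simp add: power)
  also have "\<dots> = (\<Prod>e\<in>?A. measure_pmf.expectation (bernoulli_pmf p) (\<lambda>v. if e \<in> F \<and> v then z else 1))"
    using fin z by (intro expectation_prod_Pi_pmf) (auto intro: integrable_measure_pmf_finite)
  also have "\<dots> = (\<Prod>e\<in>?A. if e \<in> F then 1 - p + p * z else 1)"
    using p by (intro prod.cong refl) (auto simp: algebra_simps)
  also have "\<dots> = (\<Prod>e\<in>{e \<in> ?A. e \<in> F}. 1 - p + p * z)"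
    by (rule prod.inter_filter[OF fin, symmetric])
  also have "{e \<in> ?A. e \<in> F} = F" using F by auto
  finally show ?thesis by simp
qed

lemma prob_le_expectation_erdos_renyi:
  fixes f :: "nat set set \<Rightarrow> real"
  assumes "\<And>G. 0 \<le> f G" "\<And>G. G \<in> S \<Longrightarrow> 1 \<le> f G"
  shows "measure_pmf.prob (erdos_renyi N p) S \<le> measure_pmf.expectation (erdos_renyi N p) f"
proof -
  have "measure_pmf.prob (erdos_renyi N p) S = measure_pmf.expectation (erdos_renyi N p) (indicator S)"
    by simp
  also have "\<dots> \<le> measure_pmf.expectation (erdos_renyi N p) f"
    using assms by (intro integral_mono integrable_erdos_renyi) (auto simp: indicator_def)
  finally show ?thesis .
qed

lemma prob_erdos_renyi_disjoint:
  assumes p: "0 \<le> p" "p \<le> 1" and F: "F \<subseteq> all_edges N"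
  shows "measure_pmf.prob (erdos_renyi N p) {G. G \<inter> F = {}} = (1 - p) ^ card F"
proof -
  have "finite F" using F finite_all_edges by (rule finite_subset)
  \<comment> \<open>With \<open>0 ^ 0 = 1\<close> the power is the indicator of missing
    \<open>F\<close>; finiteness of \<open>F\<close> guards against \<open>card\<close> being 0 on
    an infinite set.\<close>
  then have "indicator {G. G \<inter> F = {}} = (\<lambda>G. 0 ^ card (G \<inter> F) :: real)"
    by (auto simp: fun_eq_iff indicator_def power_0_left)
  moreover have "measure_pmf.prob (erdos_renyi N p) {G. G \<inter> F = {}} =
      measure_pmf.expectation (erdos_renyi N p) (indicator {G. G \<inter> F = {}})"
    by simp
  ultimately show ?thesis using expectation_erdos_renyi_power[OF p _ F, of 0] by (simp only:) simp
qed

lemma prob_erdos_renyi_disjoint_le: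
  assumes p: "0 \<le> p" "p \<le> 1" and F: "F \<subseteq> all_edges N"
  shows "measure_pmf.prob (erdos_renyi N p) {G. G \<inter> F = {}} \<le> exp (- p * card F)"
proof -
  have "(1 - p) ^ card F \<le> exp (- p) ^ card F"
    using p exp_ge_add_one_self[of "- p"] by (intro power_mono) auto
  also have "\<dots> = exp (- p * card F)" by (simp add: exp_of_nat2_mult[symmetric])
  finally show ?thesis using prob_erdos_renyi_disjoint[OF assms] by simp
qed

text \<open>Chernoff bound with \<open>t\<close> left free: a large constant is chosen later, to
  beat a union over many pairs of sets.\<close>

lemma prob_erdos_renyi_upper_tail:
  assumes p: "0 \<le> p" "p \<le> 1" and F: "F \<subseteq> all_edges N" and "0 \<le> t"
  shows "measure_pmf.prob (erdos_renyi N p) {G. m \<le> real (card (G \<inter> F))}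
    \<le> exp (p * card F * exp t - t * m)"
proof -
  have "measure_pmf.prob (erdos_renyi N p) {G. m \<le> real (card (G \<inter> F))}
      \<le> measure_pmf.expectation (erdos_renyi N p) (\<lambda>G. exp (- t * m) * exp t ^ card (G \<inter> F))"
  proof (rule prob_le_expectation_erdos_renyi)
    fix G assume "G \<in> {G. m \<le> real (card (G \<inter> F))}"
    then have "t * m \<le> t * card (G \<inter> F)" using assms by (intro mult_left_mono) auto
    then show "1 \<le> exp (- t * m) * exp t ^ card (G \<inter> F)"
      by (simp add: exp_of_nat2_mult[symmetric] exp_add[symmetric] mult.commute)
  qed simp
  also have "\<dots> = exp (- t * m) * (1 - p + p * exp t) ^ card F"
    using expectation_erdos_renyi_power[OF p _ F, of "exp t"] by simp
  also have "(1 - p + p * exp t) ^ card F \<le> exp (p * exp t) ^ card F"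
  proof (rule power_mono)
    have "0 \<le> p * exp t" using p by simp
    then show "0 \<le> 1 - p + p * exp t" "1 - p + p * exp t \<le> exp (p * exp t)"
      using p exp_ge_add_one_self[of "p * exp t"] by linarith+
  qed
  also have "exp (- t * m) * exp (p * exp t) ^ card F = exp (p * card F * exp t - t * m)"
    by (simp add: exp_of_nat2_mult[symmetric] exp_add[symmetric] mult_ac)
  finally show ?thesis by simp
qed

lemma prob_erdos_renyi_lower_tail:
  assumes p: "0 \<le> p" "p \<le> 1" and F: "F \<subseteq> all_edges N" and "0 \<le> t"
  shows "measure_pmf.prob (erdos_renyi N p) {G. real (card (G \<inter> F)) < m}
    \<le> exp (t * m - p * card F * (1 - exp (- t)))"
proof -
  have "measure_pmf.prob (erdos_renyi N p) {G. real (card (G \<inter> F)) < m}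
      \<le> measure_pmf.expectation (erdos_renyi N p) (\<lambda>G. exp (t * m) * exp (- t) ^ card (G \<inter> F))"
  proof (rule prob_le_expectation_erdos_renyi)
    fix G assume "G \<in> {G. real (card (G \<inter> F)) < m}"
    then have "t * card (G \<inter> F) \<le> t * m" using assms by (intro mult_left_mono) auto
    then show "1 \<le> exp (t * m) * exp (- t) ^ card (G \<inter> F)"
      by (simp add: exp_of_nat2_mult[symmetric] exp_add[symmetric] mult.commute)
  qed simp
  also have "\<dots> = exp (t * m) * (1 - p + p * exp (- t)) ^ card F"
    using expectation_erdos_renyi_power[OF p _ F, of "exp (- t)"] by simp
  also have "(1 - p + p * exp (- t)) ^ card F \<le> exp (- (p * (1 - exp (- t)))) ^ card F"
  proof (rule power_mono)
    have "0 \<le> p * exp (- t)" using p by simp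
    then show "0 \<le> 1 - p + p * exp (- t)" using p by linarith
    show "1 - p + p * exp (- t) \<le> exp (- (p * (1 - exp (- t))))"
      using exp_ge_add_one_self[of "- (p * (1 - exp (- t)))"] by (simp add: algebra_simps)
  qed
  also have "exp (t * m) * exp (- (p * (1 - exp (- t)))) ^ card F =
      exp (t * m - p * card F * (1 - exp (- t)))"
    by (simp add: exp_of_nat2_mult[symmetric] exp_add[symmetric] mult_ac)
  finally show ?thesis by simp
qed

text \<open>Coupling: add to the sparser graph an independent layer of density \<open>r\<close> with
  \<open>1 - p = (1 - q) * (1 - r)\<close>. The case \<open>q = 1\<close> stands apart because
  \<open>r\<close> is a quotient by \<open>1 - q\<close>.\<close>

lemma prob_erdos_renyi_mono:
  assumes "0 \<le> q" "q \<le> p" "p \<le> 1" and up: "\<And>G H. G \<in> S \<Longrightarrow> G \<subseteq> H \<Longrightarrow> H \<subseteq> all_edges N \<Longrightarrow> H \<in> S"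
  shows "measure_pmf.prob (erdos_renyi N q) S \<le> measure_pmf.prob (erdos_renyi N p) S"
proof (cases "q = 1")
  case False
  define r where "r = (p - q) / (1 - q)"
  have "r * (1 - q) = p - q" using False by (simp add: r_def)
  then have p_eq: "p = q + r - q * r" by (simp add: algebra_simps)
  have r: "0 \<le> r" "r \<le> 1" using assms(1-3) False by (auto simp: r_def divide_le_eq_1)
  let ?D = "pair_pmf (erdos_renyi N q) (erdos_renyi N r)"
  have "measure_pmf.prob (erdos_renyi N q) S = measure_pmf.prob (map_pmf fst ?D) S"
    by (simp only: map_fst_pair_pmf)
  also have "\<dots> = measure_pmf.prob ?D (fst -` S)" by (rule measure_map_pmf)
  also have "\<dots> = measure_pmf.prob ?D (fst -` S \<inter> set_pmf ?D)" by (rule measure_Int_set_pmf[symmetric])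
  also have "\<dots> \<le> measure_pmf.prob ?D ((\<lambda>(G, H). G \<union> H) -` S)"
  proof (intro measure_pmf.finite_measure_mono)
    show "fst -` S \<inter> set_pmf ?D \<subseteq> (\<lambda>(G, H). G \<union> H) -` S"
    proof
      fix x assume x: "x \<in> fst -` S \<inter> set_pmf ?D"
      obtain G H where GH: "x = (G, H)" by (cases x)
      have "G \<subseteq> all_edges N" "H \<subseteq> all_edges N"
        using x GH set_erdos_renyi[of N] by auto
      then have "G \<union> H \<in> S" using x GH by (intro up[of G "G \<union> H"]) auto
      then show "x \<in> (\<lambda>(G, H). G \<union> H) -` S" by (simp add: GH)
    qed
  qed simp
  also have "\<dots> = measure_pmf.prob (erdos_renyi N p) S"
    using r assms(1-3) by (simp add: p_eq erdos_renyi_Un)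
  finally show ?thesis .
qed (use assms(1-3) in simp)

text \<open>Conditioning on the first component: outside \<open>Bad\<close> the second contributes
  at most \<open>\<eta>\<close>, and on \<open>Bad\<close> the trivial bound 1 is used.\<close>

lemma prob_pair_pmf_le:
  assumes \<eta>: "0 \<le> \<eta>"
    and good: "\<And>x. x \<in> set_pmf A \<Longrightarrow> x \<notin> Bad \<Longrightarrow> measure_pmf.prob B {y. Q x y} \<le> \<eta>"
  shows "measure_pmf.prob (pair_pmf A B) {(x, y). Q x y} \<le> measure_pmf.prob A Bad + \<eta>"
proof -
  have "emeasure (pair_pmf A B) {(x, y). Q x y} = (\<integral>\<^sup>+x. emeasure B {y. Q x y} \<partial>A)"
  proof -
    have "(\<integral>\<^sup>+y. indicator {(x, y). Q x y} (x, y) \<partial>B) = emeasure B {y. Q x y}" for x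
    proof -
      have "(\<integral>\<^sup>+y. indicator {(x, y). Q x y} (x, y) \<partial>B) = (\<integral>\<^sup>+y. indicator {y. Q x y} y \<partial>B)"
        by (intro nn_integral_cong) (simp add: indicator_def)
      then show ?thesis by simp
    qed
    then show ?thesis by (simp add: pair_pmf_def)
  qed
  also have "\<dots> \<le> (\<integral>\<^sup>+x. indicator Bad x + ennreal \<eta> \<partial>A)"
  proof (intro nn_integral_mono_AE AE_pmfI)
    fix x assume x: "x \<in> set_pmf A"
    show "emeasure B {y. Q x y} \<le> indicator Bad x + ennreal \<eta>"
    proof (cases "x \<in> Bad")
      case True
      have "emeasure B {y. Q x y} \<le> 1" by (rule measure_pmf.emeasure_le_1)
      also have "\<dots> \<le> indicator Bad x + ennreal \<eta>" using True by simp
      finally show ?thesis .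
    next
      case False
      then show ?thesis
        using good[OF x False] by (simp add: measure_pmf.emeasure_eq_measure ennreal_leI)
    qed
  qed
  also have "\<dots> = emeasure A Bad + ennreal \<eta>"
    by (subst nn_integral_add) (simp_all add: measure_pmf.emeasure_space_1)
  finally show ?thesis
    using \<eta> by (simp add: measure_pmf.emeasure_eq_measure flip: ennreal_plus)
qed

section \<open>Isolated vertices below the threshold\<close>

definition star :: "nat \<Rightarrow> nat \<Rightarrow> nat set set" where
  "star N i = {e \<in> all_edges N. i \<in> e}"

lemma star_eq_image: "i < N \<Longrightarrow> star N i = (\<lambda>j. {i, j}) ` ({..<N} - {i})"
  by (auto simp: star_def all_edges_def card_2_iff)

lemma card_star: "i < N \<Longrightarrow> card (star N i) = N - 1"
  unfolding star_eq_image by (subst card_image) (auto simp: inj_on_def doubleton_eq_iff)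

text \<open>The two stars share exactly the edge \<open>{i, j}\<close>, the only source of
  correlation between isolated vertices.\<close>

lemma card_star_Un:
  assumes "i < N" "j < N" "i \<noteq> j"
  shows "card (star N i \<union> star N j) = 2 * N - 3"
proof -
  have "star N i \<inter> star N j = {{i, j}}"
    using assms by (auto simp: star_def all_edges_def card_2_iff)
  moreover have "finite (star N i)" "finite (star N j)"
    using assms by (simp_all add: star_eq_image)
  ultimately have "card (star N i) + card (star N j) = card (star N i \<union> star N j) + 1"
    using card_Un_Int[of "star N i" "star N j"] by simp
  then show ?thesis using assms by (simp add: card_star)
qed

lemma star_subset: "star N i \<subseteq> all_edges N"
  by (auto simp: star_def)

text \<open>Chebyshev for the number \<open>X\<close> of isolated vertices, whose mean is
  \<open>\<mu>\<close>: identifiability forces \<open>X \<le> 1\<close>. The edge shared by two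
  stars costs a factor \<open>1 / (1 - p)\<close> in the mixed moments, whence the term with
  \<open>p / (1 - p)\<close> in the variance.\<close>

lemma prob_diagonally_identifiable_le:
  assumes p: "0 \<le> p" "p < 1" and N: "N \<ge> 2" and \<mu>: "\<mu> = N * (1 - p) ^ (N - 1)" "\<mu> \<ge> 2"
  shows "measure_pmf.prob (erdos_renyi N p) {G. diagonally_identifiable N (Supp G)}
    \<le> 4 / \<mu> + 4 * (p / (1 - p))"
proof -
  let ?ER = "erdos_renyi N p" and ?q = "(1 - p) ^ (N - 1)"
  let ?E = "measure_pmf.expectation (erdos_renyi N p)"
  define I :: "nat \<Rightarrow> nat set set \<Rightarrow> real" where "I i = indicator {G. G \<inter> star N i = {}}" for i
  define X where "X G = (\<Sum>i<N. I i G)" for G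
  note int = integrable_erdos_renyi
  have EI: "?E (I i) = ?q" if "i < N" for i
    using prob_erdos_renyi_disjoint[OF p(1) less_imp_le[OF p(2)] star_subset] that
    by (simp add: I_def card_star)
  have EII: "?E (\<lambda>G. I i G * I j G) = (1 - p) ^ (2 * N - 3)" if "i < N" "j < N" "i \<noteq> j" for i j
  proof -
    have "(\<lambda>G. I i G * I j G) = indicator {G. G \<inter> (star N i \<union> star N j) = {}}"
      by (auto simp: I_def indicator_def fun_eq_iff)
    then show ?thesis
      using prob_erdos_renyi_disjoint[OF p(1) less_imp_le[OF p(2)], of "star N i \<union> star N j" N]
        star_subset card_star_Un[OF that] by simp
  qed
  have EX: "?E X = \<mu>"
    unfolding X_def by (subst Bochner_Integration.integral_sum) (auto simp: EI \<mu>(1) int)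
  have EXX: "?E (\<lambda>G. X G * X G) = \<mu> + N * (N - 1) * (1 - p) ^ (2 * N - 3)"
  proof -
    have "?E (\<lambda>G. X G * X G) = (\<Sum>i<N. \<Sum>j<N. ?E (\<lambda>G. I i G * I j G))"
      unfolding X_def sum_product
      by (simp add: Bochner_Integration.integral_sum int)
    also have "\<dots> = (\<Sum>i<N. \<Sum>j<N. if i = j then ?q else (1 - p) ^ (2 * N - 3))"
    proof (intro sum.cong refl)
      fix i j assume ij: "i \<in> {..<N}" "j \<in> {..<N}"
      have "(\<lambda>G. I i G * I i G) = I i" by (auto simp: I_def indicator_def fun_eq_iff)
      then show "?E (\<lambda>G. I i G * I j G) = (if i = j then ?q else (1 - p) ^ (2 * N - 3))"
        using ij EI[of i] EII[of i j] by auto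
    qed
    also have "\<dots> = (\<Sum>i<N. ?q + (N - 1) * (1 - p) ^ (2 * N - 3))"
    proof (intro sum.cong refl)
      fix i assume i: "i \<in> {..<N}"
      have "(\<Sum>j<N. if i = j then ?q else (1 - p) ^ (2 * N - 3)) =
          ?q + (\<Sum>j\<in>{..<N} - {i}. if i = j then ?q else (1 - p) ^ (2 * N - 3))"
        using i by (subst sum.remove[of _ i]) auto
      also have "(\<Sum>j\<in>{..<N} - {i}. if i = j then ?q else (1 - p) ^ (2 * N - 3)) =
          (\<Sum>j\<in>{..<N} - {i}. (1 - p) ^ (2 * N - 3))"
        by (intro sum.cong) auto
      also have "\<dots> = (N - 1) * (1 - p) ^ (2 * N - 3)"
        using i by simp
      finally show "(\<Sum>j<N. if i = j then ?q else (1 - p) ^ (2 * N - 3)) =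
          ?q + (N - 1) * (1 - p) ^ (2 * N - 3)" .
    qed
    finally show ?thesis by (simp add: \<mu>(1) algebra_simps)
  qed
  have var: "?E (\<lambda>G. (X G - \<mu>)\<^sup>2) \<le> \<mu> + \<mu>\<^sup>2 * (p / (1 - p))"
  proof -
    have "(1 - p) ^ (2 * N - 3) * (1 - p) = ?q * ?q"
    proof -
      have "Suc (2 * N - 3) = (N - 1) + (N - 1)" using N by simp
      then show ?thesis by (metis power_Suc2 power_add)
    qed
    then have eq: "(1 - p) ^ (2 * N - 3) = ?q * ?q / (1 - p)" using p by (simp add: field_simps)
    have "real (N * (N - 1)) \<le> real (N * N)" by (intro of_nat_mono mult_mono) auto
    then have "N * (N - 1) * (?q * ?q / (1 - p)) \<le> N * N * (?q * ?q / (1 - p))"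
      using p by (intro mult_right_mono) auto
    also have "\<dots> = \<mu>\<^sup>2 / (1 - p)" by (simp add: \<mu>(1) power2_eq_square)
    finally have le: "N * (N - 1) * (1 - p) ^ (2 * N - 3) \<le> \<mu>\<^sup>2 / (1 - p)" by (simp add: eq)
    have "?E (\<lambda>G. (X G - \<mu>)\<^sup>2) = ?E (\<lambda>G. X G * X G - 2 * \<mu> * X G + \<mu>\<^sup>2)"
      by (intro Bochner_Integration.integral_cong refl) (simp add: power2_eq_square algebra_simps)
    also have "\<dots> = ?E (\<lambda>G. X G * X G) - 2 * \<mu> * ?E X + \<mu>\<^sup>2"
      by (simp add: int)
    also have "\<dots> = \<mu> + N * (N - 1) * (1 - p) ^ (2 * N - 3) - \<mu>\<^sup>2"
      by (simp add: EX EXX power2_eq_square)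
    also have "\<dots> \<le> \<mu> + \<mu>\<^sup>2 / (1 - p) - \<mu>\<^sup>2" using le by simp
    also have "\<dots> = \<mu> + \<mu>\<^sup>2 * (p / (1 - p))" using p by (simp add: field_simps)
    finally show ?thesis .
  qed
  have few: "X G \<le> 1" if G: "G \<subseteq> all_edges N" "diagonally_identifiable N (Supp G)" for G
  proof -
    let ?S = "{i. i < N \<and> G \<inter> star N i = {}}"
    have "card ?S \<le> Suc 0"
    proof (subst card_le_Suc0_iff_eq)
      show "\<forall>u\<in>?S. \<forall>w\<in>?S. u = w"
      proof (intro ballI)
        fix u w assume uw: "u \<in> ?S" "w \<in> ?S"
        have iso: "k \<notin> e" if "k \<in> ?S" "e \<in> G" for k e
          using that G(1) by (auto simp: star_def)
        show "u = w"
          using not_diagonally_identifiable_if_isolated[OF G(1), of u w] iso[OF uw(1)] iso[OF uw(2)] uw G(2)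
          by blast
      qed
    qed simp
    moreover have "X G = real (card ?S)"
    proof -
      have "X G = (\<Sum>i\<in>{..<N}. if G \<inter> star N i = {} then 1 else 0)"
        unfolding X_def I_def by (intro sum.cong refl) (simp add: indicator_def)
      also have "\<dots> = (\<Sum>i\<in>{i \<in> {..<N}. G \<inter> star N i = {}}. 1)" by (subst sum.inter_filter) auto
      finally show ?thesis by simp
    qed
    ultimately show ?thesis by simp
  qed
  have "measure_pmf.prob ?ER {G. diagonally_identifiable N (Supp G)} =
      measure_pmf.prob ?ER ({G. diagonally_identifiable N (Supp G)} \<inter> set_pmf ?ER)"
    by (rule measure_Int_set_pmf[symmetric])
  also have "\<dots> \<le> ?E (\<lambda>G. (X G - \<mu>)\<^sup>2 / (\<mu> - 1)\<^sup>2)"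
  proof (rule prob_le_expectation_erdos_renyi)
    fix G assume "G \<in> {G. diagonally_identifiable N (Supp G)} \<inter> set_pmf ?ER"
    then have "X G \<le> 1" using few set_erdos_renyi[of N p] by auto
    then have "(\<mu> - 1)\<^sup>2 \<le> (\<mu> - X G)\<^sup>2" using \<mu>(2) by (intro power_mono) auto
    then show "1 \<le> (X G - \<mu>)\<^sup>2 / (\<mu> - 1)\<^sup>2" using \<mu>(2) by (simp add: power2_commute)
  qed simp
  also have "\<dots> = ?E (\<lambda>G. (X G - \<mu>)\<^sup>2) / (\<mu> - 1)\<^sup>2" by simp
  also have "\<dots> \<le> (\<mu> + \<mu>\<^sup>2 * (p / (1 - p))) / (\<mu> - 1)\<^sup>2"
    using var by (intro divide_right_mono) auto
  \<comment> \<open>From \<open>\<mu> \<ge> 2\<close> follows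
    \<open>\<mu> - 1 \<ge> \<mu> / 2\<close>, the origin of the factors 4.\<close>
  also have "\<dots> \<le> (\<mu> + \<mu>\<^sup>2 * (p / (1 - p))) / (\<mu> / 2)\<^sup>2"
    using p \<mu>(2) by (intro divide_left_mono power_mono mult_pos_pos) (auto intro!: add_nonneg_nonneg)
  also have "\<dots> = 4 / \<mu> + 4 * (p / (1 - p))"
    using p \<mu>(2) by (simp add: field_simps power2_eq_square)
  finally show ?thesis .
qed

section \<open>Union bounds above the threshold\<close>

lemma edges_between_subset: "X \<subseteq> {..<N} \<Longrightarrow> Y \<subseteq> {..<N} \<Longrightarrow> edges_between X Y \<subseteq> all_edges N"
  by (auto simp: edges_between_def all_edges_def)

lemma card_edges_between_disjoint:
  assumes "X \<inter> Y = {}"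
  shows "card (edges_between X Y) = card X * card Y"
proof -
  have "edges_between X Y = (\<lambda>(x, y). {x, y}) ` (X \<times> Y)"
  proof (intro equalityI subsetI)
    fix e assume "e \<in> (\<lambda>(x, y). {x, y}) ` (X \<times> Y)"
    then obtain x y where xy: "x \<in> X" "y \<in> Y" "e = {x, y}" by auto
    moreover have "x \<noteq> y" using xy assms by blast
    ultimately show "e \<in> edges_between X Y" unfolding edges_between_def by blast
  qed (auto simp: edges_between_def)
  moreover have "inj_on (\<lambda>(x, y). {x, y}) (X \<times> Y)"
    using assms by (auto simp: inj_on_def doubleton_eq_iff)
  ultimately show ?thesis by (simp add: card_image card_cartesian_product)
qed

lemma card_edges_between_le:
  assumes "finite X" "finite Y"
  shows "card (edges_between X Y) \<le> card X * card Y"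
proof -
  have "edges_between X Y \<subseteq> (\<lambda>(x, y). {x, y}) ` (X \<times> Y)"
    by (auto simp: edges_between_def)
  then have "card (edges_between X Y) \<le> card ((\<lambda>(x, y). {x, y}) ` (X \<times> Y))"
    using assms by (intro card_mono) auto
  also have "\<dots> \<le> card (X \<times> Y)" using assms by (intro card_image_le) auto
  finally show ?thesis by (simp add: card_cartesian_product)
qed

lemma prob_UN_le:
  fixes u :: real
  assumes "finite I" "S \<subseteq> (\<Union>i\<in>I. A i)" "\<And>i. i \<in> I \<Longrightarrow> measure_pmf.prob M (A i) \<le> u"
  shows "measure_pmf.prob M S \<le> card I * u"
proof -
  have "measure_pmf.prob M S \<le> measure_pmf.prob M (\<Union>i\<in>I. A i)"
    using assms(2) by (intro measure_pmf.finite_measure_mono) auto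
  also have "\<dots> \<le> (\<Sum>i\<in>I. measure_pmf.prob M (A i))"
    using assms(1) by (intro measure_pmf.finite_measure_subadditive_finite) auto
  also have "\<dots> \<le> (\<Sum>i\<in>I. u)" using assms(3) by (rule sum_mono)
  finally show ?thesis by simp
qed

text \<open>The crude count of \<open>4 ^ N\<close> pairs is affordable: for \<open>b\<close> linear
  in \<open>N\<close> and \<open>p\<close> of order \<open>ln N / N\<close> the exponent has order
  \<open>N * ln N\<close>.\<close>

lemma prob_not_joined_le:
  assumes p: "0 \<le> p" "p \<le> 1"
  shows "measure_pmf.prob (erdos_renyi N p) {G. \<not> joined N b G} \<le> 4 ^ N * exp (- p * (real b)\<^sup>2)"
proof -
  let ?I = "{(X, Y). X \<subseteq> {..<N} \<and> Y \<subseteq> {..<N} \<and> X \<inter> Y = {} \<and> card X = b \<and> card Y = b}"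
  have sub: "?I \<subseteq> Pow {..<N} \<times> Pow {..<N}" by auto
  have "measure_pmf.prob (erdos_renyi N p) {G. \<not> joined N b G} \<le> card ?I * exp (- p * (real b)\<^sup>2)"
  proof (rule prob_UN_le)
    show "finite ?I" by (rule finite_subset[OF sub]) simp
    show "{G. \<not> joined N b G} \<subseteq> (\<Union>XY\<in>?I. {G. G \<inter> edges_between (fst XY) (snd XY) = {}})"
    proof
      fix G assume "G \<in> {G. \<not> joined N b G}"
      then obtain X Y where "X \<subseteq> {..<N}" "Y \<subseteq> {..<N}" "X \<inter> Y = {}" "card X = b" "card Y = b"
        "G \<inter> edges_between X Y = {}"
        unfolding joined_def by auto
      then show "G \<in> (\<Union>XY\<in>?I. {G. G \<inter> edges_between (fst XY) (snd XY) = {}})"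
        by (intro UN_I[of "(X, Y)"]) auto
    qed
    fix XY assume XY: "XY \<in> ?I"
    then have "edges_between (fst XY) (snd XY) \<subseteq> all_edges N"
      by (intro edges_between_subset) auto
    moreover have "card (edges_between (fst XY) (snd XY)) = b * b"
      using XY by (auto simp: card_edges_between_disjoint)
    ultimately show "measure_pmf.prob (erdos_renyi N p) {G. G \<inter> edges_between (fst XY) (snd XY) = {}}
        \<le> exp (- p * (real b)\<^sup>2)"
      using prob_erdos_renyi_disjoint_le[OF p, of "edges_between (fst XY) (snd XY)" N]
      by (simp add: power2_eq_square)
  qed
  also have "\<dots> \<le> 4 ^ N * exp (- p * (real b)\<^sup>2)"
  proof (intro mult_right_mono)
    have "card ?I \<le> card (Pow {..<N} \<times> Pow {..<N})" using sub by (intro card_mono) auto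
    also have "\<dots> = 4 ^ N"
      by (simp add: card_cartesian_product card_Pow power_mult_distrib[symmetric])
    finally have "real (card ?I) \<le> real (4 ^ N)" by (rule of_nat_mono)
    then show "real (card ?I) \<le> 4 ^ N" by simp
  qed simp
  finally show ?thesis .
qed

lemma prob_no_chord_le:
  assumes p: "0 \<le> p" "p \<le> 1" and P: "distinct P" "set P \<subseteq> {..<N}" "h + 2 < length P"
  shows "measure_pmf.prob (erdos_renyi N p) {G. \<forall>i<h. {P ! i, P ! (i + 2)} \<notin> G} \<le> exp (- p * h)"
proof -
  let ?F = "(\<lambda>i. {P ! i, P ! (i + 2)}) ` {..<h}"
  have "inj_on (\<lambda>i. {P ! i, P ! (i + 2)}) {..<h}"
    using P by (auto simp: inj_on_def doubleton_eq_iff nth_eq_iff_index_eq)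
  then have card: "card ?F = h" by (simp add: card_image)
  have "P ! i < N" if "i < length P" for i using P(2) nth_mem[OF that] by auto
  then have "?F \<subseteq> all_edges N"
    using P by (auto simp: all_edges_def card_insert_if nth_eq_iff_index_eq)
  moreover have "{G. \<forall>i<h. {P ! i, P ! (i + 2)} \<notin> G} = {G. G \<inter> ?F = {}}" by auto
  ultimately show ?thesis
    using prob_erdos_renyi_disjoint_le[OF p, of ?F N] card by simp
qed

text \<open>Above the threshold this is the one bound sensitive to the constant in front of
  \<open>ln N / N\<close>: the exponent has to beat the union over \<open>N\<close> vertices. Taking
  \<open>d\<close> a small multiple of \<open>ln N\<close> keeps the loss \<open>t * d\<close>
  small.\<close>

lemma prob_low_degree_le:
  fixes d :: real
  assumes p: "0 \<le> p" "p \<le> 1" and C: "C \<subseteq> {..<N}" "real n + 1 \<le> card C" and t: "0 \<le> t"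
  shows "measure_pmf.prob (erdos_renyi N p) {G. \<exists>v<N. card (G \<inter> edges_between {v} C) < d}
    \<le> N * exp (t * d - p * n * (1 - exp (- t)))"
proof -
  have "measure_pmf.prob (erdos_renyi N p) {G. \<exists>v<N. card (G \<inter> edges_between {v} C) < d}
      \<le> card {..<N} * exp (t * d - p * n * (1 - exp (- t)))"
  proof (rule prob_UN_le)
    show "{G. \<exists>v<N. card (G \<inter> edges_between {v} C) < d} \<subseteq>
        (\<Union>v\<in>{..<N}. {G. card (G \<inter> edges_between {v} C) < d})" by auto
    fix v assume v: "v \<in> {..<N}"
    have eq: "edges_between {v} C = edges_between {v} (C - {v})" by (auto simp: edges_between_def)
    \<comment> \<open>\<open>v\<close> may itself lie in \<open>C\<close>, hence the
      \<open>+ 1\<close> in the assumption.\<close>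
    have "real n \<le> card (C - {v})" using C(2) by (cases "v \<in> C") (auto simp: card_Diff_singleton_if)
    also have "card (C - {v}) = card (edges_between {v} C)"
      unfolding eq by (subst card_edges_between_disjoint) auto
    finally have n: "n \<le> card (edges_between {v} C)" by simp
    have "measure_pmf.prob (erdos_renyi N p) {G. card (G \<inter> edges_between {v} C) < d}
        \<le> exp (t * d - p * card (edges_between {v} C) * (1 - exp (- t)))"
      using v C by (intro prob_erdos_renyi_lower_tail p t edges_between_subset) auto
    also have "\<dots> \<le> exp (t * d - p * n * (1 - exp (- t)))"
      using n p t by (auto intro!: mult_right_mono mult_left_mono)
    finally show "measure_pmf.prob (erdos_renyi N p) {G. card (G \<inter> edges_between {v} C) < d}
        \<le> exp (t * d - p * n * (1 - exp (- t)))" .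
  qed simp
  then show ?thesis by simp
qed

text \<open>For size \<open>k < m\<close> there are at most \<open>k * k \<le> k * m\<close>
  possible edges, so the Chernoff exponent is linear in \<open>k\<close> and each pair of sets fails
  with probability at most \<open>1 / N ^ (4 * k)\<close>. With at most \<open>N ^ (2 * k)\<close>
  pairs, each \<open>k\<close> costs at most \<open>1 / N ^ 2\<close>, and there are at most
  \<open>N\<close> values of \<open>k\<close>.\<close>

lemma prob_not_locally_sparse_le:
  assumes p: "0 \<le> p" "p \<le> 1" and s: "0 \<le> s" and N: "0 < N"
    and m: "p * m * exp s - s * d / 2 \<le> - 4 * ln N"
  shows "measure_pmf.prob (erdos_renyi N p) {G. \<not> locally_sparse N m d G} \<le> 1 / N"
proof -
  let ?ER = "erdos_renyi N p"
  define sub where "sub k = {S. S \<subseteq> {..<N} \<and> card S = k}" for k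
  have card_sub: "real (card (sub k \<times> sub k)) \<le> real N ^ (2 * k)" and finite_sub: "finite (sub k)"
    if "k \<le> N" for k
  proof -
    have "card (sub k) \<le> N ^ k"
      unfolding sub_def using n_subsets[of "{..<N}" k] binomial_le_pow[OF that] by simp
    then have "card (sub k) * card (sub k) \<le> N ^ k * N ^ k" by (intro mult_mono) simp_all
    then have "real (card (sub k) * card (sub k)) \<le> real (N ^ k * N ^ k)" by (rule of_nat_mono)
    then show "real (card (sub k \<times> sub k)) \<le> real N ^ (2 * k)"
      by (simp add: card_cartesian_product mult_2 power_add)
    show "finite (sub k)" by (rule finite_subset[of _ "Pow {..<N}"]) (auto simp: sub_def)
  qed
  define Bad where "Bad k = {G. \<exists>S\<in>sub k. \<exists>T\<in>sub k. real k * d \<le> 2 * real (card (G \<inter> edges_between S T))}" for k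
  have Bad: "measure_pmf.prob ?ER (Bad k) \<le> 1 / N ^ 2" if k: "1 \<le> k" "k < m" "k \<le> N" for k
  proof -
    have "measure_pmf.prob ?ER (Bad k) \<le> card (sub k \<times> sub k) * (1 / real N ^ (4 * k))"
    proof (rule prob_UN_le)
      show "finite (sub k \<times> sub k)" using finite_sub k by simp
      show "Bad k \<subseteq> (\<Union>ST\<in>sub k \<times> sub k.
          {G. real k * d / 2 \<le> real (card (G \<inter> edges_between (fst ST) (snd ST)))})"
        by (auto simp: Bad_def)
      fix ST assume ST: "ST \<in> sub k \<times> sub k"
      let ?F = "edges_between (fst ST) (snd ST)"
      have "fst ST \<subseteq> {..<N}" "snd ST \<subseteq> {..<N}" using ST by (auto simp: sub_def)
      then have fin: "finite (fst ST)" "finite (snd ST)" by (metis finite_lessThan finite_subset)+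
      have cF: "card ?F \<le> k * k" using card_edges_between_le[OF fin] ST by (auto simp: sub_def)
      have "measure_pmf.prob ?ER {G. real k * d / 2 \<le> real (card (G \<inter> ?F))}
          \<le> exp (p * card ?F * exp s - s * (real k * d / 2))"
        using ST by (intro prob_erdos_renyi_upper_tail p s edges_between_subset) (auto simp: sub_def)
      also have "p * card ?F * exp s \<le> p * (k * m) * exp s"
      proof (intro mult_right_mono mult_left_mono of_nat_mono)
        show "card ?F \<le> k * m" using cF k by (meson le_trans less_imp_le mult_le_mono2)
      qed (use p in auto)
      also have "p * (k * m) * exp s - s * (real k * d / 2) = k * (p * m * exp s - s * d / 2)"
        by (simp add: algebra_simps)
      also have "\<dots> \<le> k * (- 4 * ln N)" using m by (intro mult_left_mono) auto
      also have "exp (k * (- 4 * ln N)) = 1 / real N ^ (4 * k)"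
      proof -
        have "exp (real (4 * k) * ln N) = real N ^ (4 * k)"
          using N by (simp only: exp_of_nat_mult exp_ln of_nat_0_less_iff)
        then show ?thesis by (simp add: exp_minus inverse_eq_divide algebra_simps)
      qed
      finally show "measure_pmf.prob ?ER {G. real k * d / 2 \<le> real (card (G \<inter> ?F))} \<le> 1 / real N ^ (4 * k)"
        by simp
    qed
    also have "\<dots> \<le> real N ^ (2 * k) * (1 / real N ^ (4 * k))"
      using card_sub[OF k(3)] by (intro mult_right_mono) auto
    also have "\<dots> = 1 / real N ^ (2 * k)"
    proof -
      have "4 * k = 2 * k + 2 * k" by simp
      then have "real N ^ (4 * k) = real N ^ (2 * k) * real N ^ (2 * k)" by (metis power_add)
      then show ?thesis using N by simp
    qed
    also have "\<dots> \<le> 1 / N ^ 2" using N k by (intro divide_left_mono) (auto intro!: power_increasing)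
    finally show ?thesis .
  qed
  have "measure_pmf.prob ?ER {G. \<not> locally_sparse N m d G} \<le> card {k. 1 \<le> k \<and> k < m \<and> k \<le> N} * (1 / N ^ 2)"
  proof (rule prob_UN_le)
    show "{G. \<not> locally_sparse N m d G} \<subseteq> (\<Union>k\<in>{k. 1 \<le> k \<and> k < m \<and> k \<le> N}. Bad k)"
    proof
      fix G assume "G \<in> {G. \<not> locally_sparse N m d G}"
      then obtain S T where ST: "S \<subseteq> {..<N}" "T \<subseteq> {..<N}" "S \<noteq> {}" "card S < m" "card T = card S"
        "real (card S) * d \<le> 2 * real (card (G \<inter> edges_between S T))"
        unfolding locally_sparse_def by (auto simp: not_less)
      have "finite S" using ST(1) by (rule finite_subset) simp
      then have "1 \<le> card S" using ST(3) by (simp add: Suc_le_eq card_gt_0_iff)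
      moreover have "card S \<le> N" using card_mono[OF _ ST(1)] by simp
      moreover have "G \<in> Bad (card S)" using ST by (auto simp: Bad_def sub_def)
      ultimately show "G \<in> (\<Union>k\<in>{k. 1 \<le> k \<and> k < m \<and> k \<le> N}. Bad k)" using ST(4) by blast
    qed
  qed (use Bad in auto)
  also have "\<dots> \<le> real N * (1 / N ^ 2)"
  proof (intro mult_right_mono of_nat_mono)
    have "card {k. 1 \<le> k \<and> k < m \<and> k \<le> N} \<le> card {1..N}" by (intro card_mono) auto
    then show "card {k. 1 \<le> k \<and> k < m \<and> k \<le> N} \<le> N" by simp
  qed simp
  also have "\<dots> = 1 / N" using N by (simp add: power2_eq_square)
  finally show ?thesis .
qed

section \<open>The two phases\<close>

lemma prob_diagonally_identifiable_ge:
  fixes b h n N :: nat and p p1 p2 d s t :: real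
  assumes p1: "0 \<le> p1" "p1 \<le> 1" and p2: "0 \<le> p2" "p2 \<le> 1" and p: "p1 + p2 \<le> p" "p \<le> 1"
    and t: "0 \<le> t" and s: "0 \<le> s" and h: "h + 2 + 2 * b < N" and n: "n + 1 + 2 * b + h \<le> N"
    and m: "p2 * real (2 * b) * exp s - s * d / 2 \<le> - 4 * ln N"
  shows "1 - (4 ^ N * exp (- p1 * (real b)\<^sup>2) + (exp (- p2 * h) + 1 / N
      + N * exp (t * d - p2 * n * (1 - exp (- t)))))
    \<le> measure_pmf.prob (erdos_renyi N p) {G. diagonally_identifiable N (Supp G)}"
proof -
  \<comment> \<open>A fixed choice for each first layer, so that conditioning on \<open>K\<close>
    fixes the path as well.\<close>
  define path where "path K = (SOME P. distinct P \<and> set P \<subseteq> {..<N} \<and>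
      successively (\<lambda>x y. {x, y} \<in> K) P \<and> N \<le> length P + 2 * b)" for K
  have path: "distinct (path K)" "set (path K) \<subseteq> {..<N}"
      "successively (\<lambda>x y. {x, y} \<in> K) (path K)" "N \<le> length (path K) + 2 * b"
    if "joined N b K" for K
    using someI_ex[OF joined_imp_long_path[OF that]] unfolding path_def by blast+
  define good where "good K H \<longleftrightarrow> H \<subseteq> all_edges N \<and> joined N b K \<and>
      (\<exists>i<h. {path K ! i, path K ! (i + 2)} \<in> H) \<and> locally_sparse N (2 * b) d H \<and>
      (\<forall>v<N. d \<le> real (card (H \<inter> edges_between {v} (set (drop h (path K))))))" for K H
  \<comment> \<open>Upward closed by construction, so that the bound at \<open>?q\<close> carries
    over to the larger \<open>p\<close>.\<close>
  define S where "S = {G. \<exists>K H. good K H \<and> K \<subseteq> G \<and> H \<subseteq> G}"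
  let ?D = "pair_pmf (erdos_renyi N p1) (erdos_renyi N p2)"
  let ?q = "p1 + p2 - p1 * p2"
  let ?\<eta> = "exp (- p2 * h) + 1 / N + N * exp (t * d - p2 * n * (1 - exp (- t)))"
  have bad: "measure_pmf.prob ?D {(K, H). \<not> good K H} \<le>
      measure_pmf.prob (erdos_renyi N p1) {K. \<not> joined N b K} + ?\<eta>"
  proof (rule prob_pair_pmf_le)
    show "0 \<le> ?\<eta>" by (intro add_nonneg_nonneg) auto
    fix K assume "K \<notin> {K. \<not> joined N b K}"
    then have K: "joined N b K" by simp
    note P = path[OF K]
    let ?C = "set (drop h (path K))" and ?M = "erdos_renyi N p2"
    let ?B1 = "{H. \<forall>i<h. {path K ! i, path K ! (i + 2)} \<notin> H}"
    let ?B2 = "{H. \<not> locally_sparse N (2 * b) d H}"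
    let ?B3 = "{H. \<exists>v<N. card (H \<inter> edges_between {v} ?C) < d}"
    have B1: "measure_pmf.prob ?M ?B1 \<le> exp (- p2 * h)"
      using P h by (intro prob_no_chord_le p2) auto
    have B2: "measure_pmf.prob ?M ?B2 \<le> 1 / N"
      using h m by (intro prob_not_locally_sparse_le[OF p2 s]) auto
    have B3: "measure_pmf.prob ?M ?B3 \<le> N * exp (t * d - p2 * n * (1 - exp (- t)))"
    proof (rule prob_low_degree_le[OF p2 _ _ t])
      show "?C \<subseteq> {..<N}" using P(2) set_drop_subset[of h "path K"] by blast
      have "card ?C = length (path K) - h" using P(1) by (simp add: distinct_card)
      then show "real n + 1 \<le> real (card ?C)" using n P(4) by linarith
    qed
    have "measure_pmf.prob ?M {H. \<not> good K H} = measure_pmf.prob ?M ({H. \<not> good K H} \<inter> set_pmf ?M)"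
      by (rule measure_Int_set_pmf[symmetric])
    also have "\<dots> \<le> measure_pmf.prob ?M (?B1 \<union> ?B2 \<union> ?B3)"
    proof (intro measure_pmf.finite_measure_mono)
      show "{H. \<not> good K H} \<inter> set_pmf ?M \<subseteq> ?B1 \<union> ?B2 \<union> ?B3"
        using set_erdos_renyi[of N p2] K by (auto simp: good_def not_le)
    qed simp
    also have "\<dots> \<le> measure_pmf.prob ?M (?B1 \<union> ?B2) + measure_pmf.prob ?M ?B3"
      by (rule measure_Un_le) auto
    also have "measure_pmf.prob ?M (?B1 \<union> ?B2) \<le> measure_pmf.prob ?M ?B1 + measure_pmf.prob ?M ?B2"
      by (rule measure_Un_le) auto
    finally show "measure_pmf.prob ?M {H. \<not> good K H} \<le> ?\<eta>" using B1 B2 B3 by linarith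
  qed
  have "measure_pmf.prob ?D {(K, H). good K H} = 1 - measure_pmf.prob ?D {(K, H). \<not> good K H}"
  proof -
    have "{(K, H). good K H} = space (measure_pmf ?D) - {(K, H). \<not> good K H}" by auto
    then show ?thesis by (simp only: measure_pmf.prob_compl sets_measure_pmf UNIV_I)
  qed
  then have "1 - (4 ^ N * exp (- p1 * (real b)\<^sup>2) + ?\<eta>) \<le> measure_pmf.prob ?D {(K, H). good K H}"
    using bad prob_not_joined_le[OF p1, of N b] by linarith
  also have "\<dots> \<le> measure_pmf.prob ?D ((\<lambda>(K, H). K \<union> H) -` S)"
    by (intro measure_pmf.finite_measure_mono) (auto simp: S_def)
  also have "\<dots> = measure_pmf.prob (erdos_renyi N ?q) S"
    using p1 p2 by (simp add: erdos_renyi_Un)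
  also have "\<dots> \<le> measure_pmf.prob (erdos_renyi N p) S"
  proof (rule prob_erdos_renyi_mono)
    have "p1 * p2 \<le> 1 * p2" using p1 p2 by (intro mult_right_mono) auto
    then show "0 \<le> ?q" using p1 by simp
    have "0 \<le> p1 * p2" using p1 p2 by simp
    then show "?q \<le> p" using p by linarith
    show "H \<in> S" if "G \<in> S" "G \<subseteq> H" for G H
      using that unfolding S_def by blast
  qed (rule p(2))
  also have "\<dots> = measure_pmf.prob (erdos_renyi N p) (S \<inter> set_pmf (erdos_renyi N p))"
    by (rule measure_Int_set_pmf[symmetric])
  also have "\<dots> \<le> measure_pmf.prob (erdos_renyi N p) {G. diagonally_identifiable N (Supp G)}"
  proof (intro measure_pmf.finite_measure_mono subsetI)
    fix G assume "G \<in> S \<inter> set_pmf (erdos_renyi N p)"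
    then obtain K H where G: "G \<subseteq> all_edges N" "K \<subseteq> G" "H \<subseteq> G" and good: "good K H"
      using set_erdos_renyi[of N p] by (auto simp: S_def)
    then obtain i where i: "i < h" "{path K ! i, path K ! (i + 2)} \<in> H"
      and K: "joined N b K" and sparse: "locally_sparse N (2 * b) d H"
      and deg: "\<And>v. v < N \<Longrightarrow> d \<le> real (card (H \<inter> edges_between {v} (set (drop h (path K)))))"
      unfolding good_def by blast
    have "h + 2 < length (path K)" using path(4)[OF K] h by linarith
    then have "diagonally_identifiable N (Supp G)"
      by (rule diagonally_identifiable_of_layers[OF G(1,3,2) K path(1-3)[OF K] i(1) _ i(2) sparse deg])
    then show "G \<in> {G. diagonally_identifiable N (Supp G)}" by simp
  qed simp
  finally show ?thesis .
qed

lemma identifiable_above_threshold: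
  fixes p :: "nat \<Rightarrow> real"
  assumes p01: "\<And>N. N \<ge> 1 \<Longrightarrow> p N \<in> {0..1}" and e: "0 < e" "e \<le> 1"
    and p: "\<And>N. N \<ge> 1 \<Longrightarrow> p N \<ge> (1 + e) * (ln (real N) / real N)"
  shows "(\<lambda>N. measure_pmf.prob (erdos_renyi N (p N)) {G. diagonally_identifiable N (Supp G)})
    \<longlonglongrightarrow> 1"
proof -
  define \<rho> where "\<rho> = e / 16"
  define t where "t = - ln \<rho>"
  \<comment> \<open>Degrees are asked to be at least \<open>c * ln N\<close>; then
    \<open>t * (c * ln N)\<close> uses \<open>e / 8\<close> of the surplus \<open>e / 4\<close>, and
    the rest makes the bound tend to 0.\<close>
  define c where "c = e / (8 * t)"
  \<comment> \<open>Makes the gain in the sparsity exponent \<open>5 * ln N\<close>; the bound on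
    \<open>\<beta>\<close> by \<open>exp (- s) / 8\<close> keeps the other term below
    \<open>ln N\<close>, and the bound by \<open>e / 96\<close> keeps \<open>3 * b N + 1\<close>
    below \<open>\<rho> * N\<close>, both for large \<open>N\<close>.\<close>
  define s where "s = 10 / c"
  define \<beta> where "\<beta> = min (e / 96) (exp (- s) / 8)"
  define b where "b N = nat \<lceil>\<beta> * real N\<rceil>" for N
  \<comment> \<open>\<open>b N\<close> is both the size of joined sets and the number of chord
    positions: the path misses at most \<open>2 * b N\<close> vertices, its head takes
    \<open>b N\<close> more, and one is subtracted for the vertex whose degree is counted.\<close>
  define n where "n N = N - (3 * b N + 1)" for N
  define u where "u N = 4 ^ N * exp (- (e / 4 * \<beta>\<^sup>2) * (real N * ln (real N))) +
      (exp (- \<beta> * ln (real N)) + 1 / real N + exp (- (e / 8) * ln (real N)))" for N :: nat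
  have \<rho>: "0 < \<rho>" "\<rho> < 1" using e by (auto simp: \<rho>_def)
  then have t: "0 < t" "exp (- t) = \<rho>" by (auto simp: t_def)
  have c: "0 < c" using e t by (simp add: c_def)
  have s: "0 < s" using c by (simp add: s_def)
  have \<beta>: "0 < \<beta>" "\<beta> \<le> e / 96" "\<beta> * exp s \<le> 1 / 8"
  proof -
    show "0 < \<beta>" "\<beta> \<le> e / 96" using e by (auto simp: \<beta>_def)
    have "\<beta> * exp s \<le> exp (- s) / 8 * exp s" by (intro mult_right_mono) (auto simp: \<beta>_def)
    then show "\<beta> * exp s \<le> 1 / 8" by (simp add: exp_minus)
  qed
  have "u \<longlonglongrightarrow> 0"
  proof -
    define \<gamma> where "\<gamma> = e / 4 * \<beta>\<^sup>2"
    have "0 < \<gamma>" using e \<beta> by (simp add: \<gamma>_def)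
    then have "(\<lambda>N::nat. 4 ^ N * exp (- \<gamma> * (real N * ln (real N)))) \<longlonglongrightarrow> 0"
      by real_asymp
    moreover have "(\<lambda>N::nat. exp (- \<beta> * ln (real N))) \<longlonglongrightarrow> 0" using \<beta>(1) by real_asymp
    moreover have "(\<lambda>N::nat. exp (- (e / 8) * ln (real N))) \<longlonglongrightarrow> 0" using e(1) by real_asymp
    moreover have "(\<lambda>N::nat. 1 / real N) \<longlonglongrightarrow> 0" by real_asymp
    ultimately have "(\<lambda>N. 4 ^ N * exp (- \<gamma> * (real N * ln (real N))) +
      (exp (- \<beta> * ln (real N)) + 1 / real N + exp (- (e / 8) * ln (real N)))) \<longlonglongrightarrow> 0 + (0 + 0 + 0)"
      by (intro tendsto_add)
    then show ?thesis unfolding u_def[abs_def] \<gamma>_def by simp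
  qed
  then have lim: "(\<lambda>N. 1 - u N) \<longlonglongrightarrow> 1" by (auto intro!: tendsto_eq_intros)
  have ev: "eventually (\<lambda>N. 2 * (ln (real N) / real N) \<le> 1) sequentially"
    "eventually (\<lambda>N. 2 \<le> N) sequentially"
    "eventually (\<lambda>N. 8 * exp s \<le> real N) sequentially" "eventually (\<lambda>N. 128 / e \<le> real N) sequentially"
    using e by (real_asymp, auto intro: eventually_ge_at_top
        eventually_compose_filterlim[OF eventually_ge_at_top filterlim_real_sequentially])
  have "eventually (\<lambda>N. 1 - u N \<le>
      measure_pmf.prob (erdos_renyi N (p N)) {G. diagonally_identifiable N (Supp G)}) sequentially"
    using ev
  proof eventually_elim
    case (elim N)
    define L where "L = ln (real N)"
    have N: "0 < real N" using elim(2) by simp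
    have L: "0 < L" using elim(2) by (simp add: L_def)
    have LN: "0 \<le> L / N" using L N by simp
    define p1 where "p1 = e / 4 * (L / N)"
    define p2 where "p2 = (1 + e / 2) * (L / N)"
    have p1: "0 \<le> p1" "p1 \<le> 1"
    proof -
      show "0 \<le> p1" unfolding p1_def using e by (intro mult_nonneg_nonneg LN) simp
      have "p1 \<le> 2 * (L / N)" unfolding p1_def using e LN by (intro mult_right_mono) auto
      then show "p1 \<le> 1" using elim(1) by (simp add: L_def)
    qed
    have p2_le: "p2 \<le> 2 * (L / N)" unfolding p2_def using e LN by (intro mult_right_mono) auto
    have p2: "0 \<le> p2" "p2 \<le> 1"
    proof -
      show "0 \<le> p2" unfolding p2_def using e by (intro mult_nonneg_nonneg LN) simp
      show "p2 \<le> 1" using p2_le elim(1) by (simp add: L_def)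
    qed
    have "p1 + p2 \<le> (1 + e) * (L / N)"
      unfolding p1_def p2_def ring_distribs(2)[symmetric] using e LN by (intro mult_right_mono) auto
    then have p12: "p1 + p2 \<le> p N" "p N \<le> 1"
      using p[of N] p01[of N] elim(2) by (auto simp: L_def)
    have b: "\<beta> * N \<le> b N" "b N \<le> \<beta> * N + 1"
    proof -
      have "0 \<le> \<beta> * N" using \<beta>(1) by simp
      then show "\<beta> * N \<le> b N" "b N \<le> \<beta> * N + 1" unfolding b_def by linarith+
    qed
    have bn: "real (3 * b N + 1) \<le> \<rho> * N"
    proof -
      have "\<beta> * N \<le> e / 96 * N" using \<beta>(2) N by (intro mult_right_mono) auto
      moreover have "128 \<le> e * N" using elim(4) e by (simp add: field_simps)
      ultimately show ?thesis using b(2) by (simp add: \<rho>_def)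
    qed
    have "\<rho> * N \<le> 1 / 16 * N" using e N by (intro mult_right_mono) (auto simp: \<rho>_def)
    moreover have "128 \<le> N"
    proof -
      have "128 \<le> e * N" using elim(4) e by (simp add: field_simps)
      also have "\<dots> \<le> 1 * real N" using e N by (intro mult_right_mono) auto
      finally show ?thesis by simp
    qed
    ultimately have b3: "real (3 * b N + 1) + 8 \<le> N" using bn N by linarith
    then have b3': "3 * b N + 9 \<le> N" by linarith
    have n: "(1 - \<rho>) * N \<le> n N"
      using bn b3' by (simp add: n_def of_nat_diff algebra_simps)
    have sparse: "p2 * real (2 * b N) * exp s - s * (c * L) / 2 \<le> - 4 * ln N"
    proof -
      have "p2 * real (2 * b N) * exp s \<le> 2 * (L / N) * (2 * (\<beta> * N + 1)) * exp s"
        using p2 p2_le b(2) LN by (intro mult_right_mono mult_mono) auto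
      also have "\<dots> = 4 * L * (\<beta> * exp s + exp s / N)" using N by (simp add: field_simps)
      also have "\<dots> \<le> 4 * L * (1 / 8 + 1 / 8)"
        using L \<beta>(3) elim(3) N by (intro mult_left_mono add_mono) (auto simp: field_simps)
      finally have "p2 * real (2 * b N) * exp s \<le> L" by simp
      moreover have "s * (c * L) / 2 = 5 * L" using c by (simp add: s_def)
      ultimately show ?thesis unfolding L_def[symmetric] by linarith
    qed
    have T1: "4 ^ N * exp (- p1 * (real (b N))\<^sup>2) \<le> 4 ^ N * exp (- (e / 4 * \<beta>\<^sup>2) * (N * ln N))"
    proof -
      have "(\<beta> * N)\<^sup>2 \<le> (real (b N))\<^sup>2" using b(1) \<beta> N by (intro power_mono) auto
      then have "p1 * (\<beta> * N)\<^sup>2 \<le> p1 * (real (b N))\<^sup>2" using p1 by (intro mult_left_mono)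
      moreover have "p1 * (\<beta> * N)\<^sup>2 = e / 4 * \<beta>\<^sup>2 * (N * ln N)"
        using N by (simp add: p1_def L_def power2_eq_square)
      ultimately show ?thesis by simp
    qed
    have T2: "exp (- p2 * b N) \<le> exp (- \<beta> * ln N)"
    proof -
      have "1 * (L / N) \<le> p2" unfolding p2_def using e by (intro mult_right_mono LN) simp
      then have "L / N * (\<beta> * N) \<le> p2 * b N" using b(1) \<beta>(1) p2(1) by (intro mult_mono) auto
      then show ?thesis using N by (simp add: L_def mult.commute)
    qed
    have T3: "N * exp (t * (c * L) - p2 * n N * (1 - exp (- t))) \<le> exp (- (e / 8) * ln N)"
    proof -
      have "(1 + e / 4) * L \<le> (1 + e / 2) * ((1 - \<rho>) * (1 - \<rho>)) * L"
      proof (intro mult_right_mono)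
        have "(1 + e / 2) * ((1 - \<rho>) * (1 - \<rho>)) - (1 + e / 4) = e * (1 / 8 - 15 * e / 256 + e * e / 512)"
          by (simp add: \<rho>_def field_simps)
        moreover have "0 \<le> e * (1 / 8 - 15 * e / 256 + e * e / 512)"
        proof (intro mult_nonneg_nonneg)
          have "0 \<le> e * e" by simp
          then show "0 \<le> 1 / 8 - 15 * e / 256 + e * e / 512" using e by linarith
        qed (use e in simp)
        ultimately show "1 + e / 4 \<le> (1 + e / 2) * ((1 - \<rho>) * (1 - \<rho>))" by linarith
      qed (use L in simp)
      also have "\<dots> = p2 * ((1 - \<rho>) * N) * (1 - \<rho>)" using N by (simp add: p2_def)
      also have "\<dots> \<le> p2 * n N * (1 - \<rho>)"
        using n p2 \<rho> by (intro mult_right_mono mult_left_mono) auto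
      finally have "(1 + e / 4) * L \<le> p2 * n N * (1 - exp (- t))" by (simp add: t(2))
      moreover have "t * (c * L) = e / 8 * L" using t by (simp add: c_def)
      moreover have "(1 + e / 4) * L = L + e / 8 * L + e / 8 * L" by (simp add: algebra_simps)
      ultimately have "L + (t * (c * L) - p2 * n N * (1 - exp (- t))) \<le> - (e / 8) * L"
        by linarith
      then have "exp (L + (t * (c * L) - p2 * n N * (1 - exp (- t)))) \<le> exp (- (e / 8) * L)" by simp
      then show ?thesis using N by (simp add: exp_add L_def)
    qed
    have "1 - u N \<le> 1 - (4 ^ N * exp (- p1 * (real (b N))\<^sup>2) + (exp (- p2 * b N) + 1 / N
        + N * exp (t * (c * L) - p2 * n N * (1 - exp (- t)))))"
      using T1 T2 T3 unfolding u_def by linarith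
    also have "\<dots> \<le> measure_pmf.prob (erdos_renyi N (p N)) {G. diagonally_identifiable N (Supp G)}"
      by (rule prob_diagonally_identifiable_ge[OF p1 p2 p12 less_imp_le[OF t(1)] less_imp_le[OF s] _ _ sparse])
        (use b3' in \<open>auto simp: n_def\<close>)
    finally show ?case .
  qed
  then show ?thesis
    by (rule tendsto_sandwich[OF _ _ lim tendsto_const]) auto
qed

lemma not_identifiable_below_threshold:
  fixes p :: "nat \<Rightarrow> real"
  assumes p01: "\<And>N. N \<ge> 1 \<Longrightarrow> p N \<in> {0..1}" and e: "0 < e" "e < 1"
    and p: "\<And>N. N \<ge> 1 \<Longrightarrow> p N \<le> (1 - e) * (ln (real N) / real N)"
  shows "(\<lambda>N. measure_pmf.prob (erdos_renyi N (p N)) {G. diagonally_identifiable N (Supp G)})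
    \<longlonglongrightarrow> 0"
proof -
  define a where "a = 1 - e"
  have a: "0 < a" "a < 1" using e by (auto simp: a_def)
  define q where "q N = a * (ln (real N) / real N)" for N :: nat
  \<comment> \<open>A lower bound for the mean number of isolated vertices, from
    \<open>ln (1 - q) \<ge> - q - 2 * q\<^sup>2\<close>; it grows like \<open>N\<close> to the power
    \<open>e\<close>.\<close>
  define g where "g N = real N * exp (- (real N * (q N + 2 * (q N)\<^sup>2)))" for N :: nat
  have g: "filterlim g at_top sequentially"
    unfolding g_def q_def using a by real_asymp
  have q: "q \<longlonglongrightarrow> 0" unfolding q_def by real_asymp
  define u where "u N = 4 / g N + 4 * (q N / (1 - q N))" for N
  have "u \<longlonglongrightarrow> 0 + 4 * (0 / (1 - 0))"
    unfolding u_def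
    by (intro tendsto_intros q real_tendsto_divide_at_top[OF tendsto_const g]) auto
  then have u: "u \<longlonglongrightarrow> 0" by simp
  have ev: "eventually (\<lambda>N. q N \<le> 1 / 2) sequentially" "eventually (\<lambda>N. 2 \<le> g N) sequentially"
    "eventually (\<lambda>N. 2 \<le> N) sequentially"
    using order_tendstoD(2)[OF q, of "1 / 2"] g
    by (auto simp: filterlim_at_top eventually_ge_at_top elim: eventually_mono)
  have "eventually (\<lambda>N. measure_pmf.prob (erdos_renyi N (p N)) {G. diagonally_identifiable N (Supp G)} \<le> u N)
      sequentially"
    using ev
  proof eventually_elim
    case (elim N)
    have N: "N \<ge> 1" using elim by simp
    have pN: "0 \<le> p N" "p N \<le> q N" using p01[OF N] p[OF N] by (auto simp: q_def a_def)
    have q0: "0 \<le> q N" using pN by linarith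
    define \<mu> where "\<mu> = N * (1 - p N) ^ (N - 1)"
    have "g N \<le> \<mu>"
      unfolding g_def \<mu>_def
    proof (intro mult_left_mono)
      have "exp (- (real N * (q N + 2 * (q N)\<^sup>2))) = exp (- q N - 2 * (q N)\<^sup>2) ^ N"
        by (simp add: exp_of_nat_mult[symmetric] algebra_simps)
      also have "\<dots> \<le> (1 - q N) ^ N"
      proof (intro power_mono)
        have "- q N - 2 * (q N)\<^sup>2 \<le> ln (1 - q N)"
          using q0 elim(1) by (intro ln_one_minus_pos_lower_bound)
        then have "exp (- q N - 2 * (q N)\<^sup>2) \<le> exp (ln (1 - q N))" by simp
        then show "exp (- q N - 2 * (q N)\<^sup>2) \<le> 1 - q N" using elim(1) by simp
      qed simp
      also have "\<dots> \<le> (1 - p N) ^ N" using pN elim(1) by (intro power_mono) auto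
      also have "\<dots> \<le> (1 - p N) ^ (N - 1)" using pN elim(1) by (intro power_decreasing) auto
      finally show "exp (- (real N * (q N + 2 * (q N)\<^sup>2))) \<le> (1 - p N) ^ (N - 1)" .
    qed simp
    have "measure_pmf.prob (erdos_renyi N (p N)) {G. diagonally_identifiable N (Supp G)}
        \<le> 4 / \<mu> + 4 * (p N / (1 - p N))"
      using pN elim \<open>g N \<le> \<mu>\<close> by (intro prob_diagonally_identifiable_le \<mu>_def) auto
    also have "\<dots> \<le> u N"
      unfolding u_def using pN elim \<open>g N \<le> \<mu>\<close>
      by (intro add_mono divide_left_mono mult_left_mono frac_le) auto
    finally show ?case .
  qed
  then show ?thesis
    by (rule tendsto_sandwich[OF _ _ tendsto_const u, rotated]) auto
qed

theorem theorem5: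
  fixes p :: "nat \<Rightarrow> real"
  assumes "\<And>N. N \<ge> 1 \<Longrightarrow> p N \<in> {0..1}"
  shows "\<forall>\<epsilon>>0.
    ((\<forall>N\<ge>1. p N \<ge> (1 + \<epsilon>) * (ln (real N) / real N)) \<longrightarrow>
      (\<lambda>N. measure_pmf.prob (erdos_renyi N (p N)) {G. diagonally_identifiable N (Supp G)})
        \<longlonglongrightarrow> 1) \<and>
    ((\<forall>N\<ge>1. p N \<le> (1 - \<epsilon>) * (ln (real N) / real N)) \<longrightarrow>
      (\<lambda>N. measure_pmf.prob (erdos_renyi N (p N)) {G. diagonally_identifiable N (Supp G)})
        \<longlonglongrightarrow> 0)"
proof (intro allI impI conjI)
  fix \<epsilon> :: real assume \<epsilon>: "0 < \<epsilon>"
  \<comment> \<open>As \<open>ln N / N\<close> is nonnegative, lowering \<open>\<epsilon>\<close>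
    weakens both hypotheses; so \<open>\<epsilon>\<close> is capped at 1 above and at 1/2 below the
    threshold, to meet the ranges of the two phase lemmas.\<close>
  have LN: "0 \<le> ln (real N) / real N" if "1 \<le> N" for N :: nat using that by simp
  {
    assume p: "\<forall>N\<ge>1. p N \<ge> (1 + \<epsilon>) * (ln (real N) / real N)"
    have "(1 + min \<epsilon> 1) * (ln (real N) / real N) \<le> p N" if "1 \<le> N" for N
      using p[rule_format, OF that] mult_right_mono[OF _ LN[OF that], of "1 + min \<epsilon> 1" "1 + \<epsilon>"] by simp
    then show "(\<lambda>N. measure_pmf.prob (erdos_renyi N (p N)) {G. diagonally_identifiable N (Supp G)})
        \<longlonglongrightarrow> 1"
      using \<epsilon> by (intro identifiable_above_threshold[OF assms, where e = "min \<epsilon> 1"]) auto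
  next
    assume p: "\<forall>N\<ge>1. p N \<le> (1 - \<epsilon>) * (ln (real N) / real N)"
    have "p N \<le> (1 - min \<epsilon> (1 / 2)) * (ln (real N) / real N)" if "1 \<le> N" for N
      using p[rule_format, OF that] mult_right_mono[OF _ LN[OF that], of "1 - \<epsilon>" "1 - min \<epsilon> (1 / 2)"] by simp
    then show "(\<lambda>N. measure_pmf.prob (erdos_renyi N (p N)) {G. diagonally_identifiable N (Supp G)})
        \<longlonglongrightarrow> 0"
      using \<epsilon> by (intro not_identifiable_below_threshold[OF assms, where e = "min \<epsilon> (1 / 2)"]) auto
  }
qed

end
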